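(* Let $m \ge 2$ and let $F_m$ be the free group of rank $m$. There exist two elements $u_1, u_2 \in F_m$ such that any endomorphism $\psi$ of $F_m$ with non-cyclic image is uniquely determined by $\psi(u_1)$, $\psi(u_2)$; that is, whenever $\phi$, $\psi$ are endomorphisms of $F_m$ with non-cyclic images and $\phi(u_i) = \psi(u_i)$ for $i = 1, 2$, it follows that $\phi = \psi$.
   Context: The trivial group is cyclic. *)

theory Defs
  imports "HOL-Algebra.Elementary_Groups"
begin

text \<open>
  A letter \<open>(x, True)\<close> stands for the generator \<open>x\<close> and \<open>(x, False)\<close> for its formal inverse.
\<close>

type_synonym 'a letter = "'a \<times> bool"

definition inv_letter :: "'a letter \<Rightarrow> 'a letter" where
  "inv_letter a = (fst a, \<not> snd a)"

definition reduced :: "'a letter list \<Rightarrow> bool" where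
  "reduced w \<longleftrightarrow> successively (\<lambda>a b. b \<noteq> inv_letter a) w"

fun cancel_cons :: "'a letter \<Rightarrow> 'a letter list \<Rightarrow> 'a letter list" where
  "cancel_cons a [] = [a]"
| "cancel_cons a (b # w) = (if b = inv_letter a then w else a # b # w)"

definition reduce :: "'a letter list \<Rightarrow> 'a letter list" where
  "reduce w = foldr cancel_cons w []"

definition free_group :: "'a set \<Rightarrow> 'a letter list monoid" where
  "free_group X =
     \<lparr>carrier = {w. reduced w \<and> set w \<subseteq> X \<times> UNIV},
      monoid.mult = (\<lambda>u v. reduce (u @ v)),
      one = []\<rparr>"

lemma inv_letter_inv_letter [simp]: "inv_letter (inv_letter a) = a"
  by (simp add: inv_letter_def)

lemma reduced_Nil [simp]: "reduced []"
  by (simp add: reduced_def)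

lemma reduced_Cons:
  "reduced (a # w) \<longleftrightarrow> (w = [] \<or> hd w \<noteq> inv_letter a) \<and> reduced w"
  by (auto simp: reduced_def successively_Cons)

lemma reduced_cancel_cons: "reduced w \<Longrightarrow> reduced (cancel_cons a w)"
  by (cases w) (auto simp: reduced_Cons)

lemma cancel_cons_reduced: "reduced (a # w) \<Longrightarrow> cancel_cons a w = a # w"
  by (cases w) (auto simp: reduced_Cons)

lemma cancel_cons_inv_letter:
  assumes "reduced w"
  shows "cancel_cons a (cancel_cons (inv_letter a) w) = w"
proof (cases w)
  case (Cons b v)
  with assms show ?thesis
    by (cases v) (auto simp: reduced_Cons)
qed simp

lemma reduced_foldr_cancel_cons: "reduced w \<Longrightarrow> reduced (foldr cancel_cons u w)"
  by (induction u) (auto intro: reduced_cancel_cons)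

lemma reduced_reduce: "reduced (reduce w)"
  by (simp add: reduce_def reduced_foldr_cancel_cons)

lemma reduce_reduced: "reduced w \<Longrightarrow> reduce w = w"
  by (induction w) (auto simp: reduce_def reduced_Cons intro!: cancel_cons_reduced)

lemma foldr_cancel_cons_cancel_cons:
  assumes "reduced w"
  shows "foldr cancel_cons (cancel_cons a u) w = cancel_cons a (foldr cancel_cons u w)"
proof (cases u)
  case (Cons b v)
  then show ?thesis
    using cancel_cons_inv_letter[OF reduced_foldr_cancel_cons[OF assms], of a v] by simp
qed simp

lemma foldr_cancel_cons_reduce:
  "reduced w \<Longrightarrow> foldr cancel_cons (reduce u) w = foldr cancel_cons u w"
  by (induction u) (auto simp: reduce_def foldr_cancel_cons_cancel_cons)

lemma reduce_append: "reduce (u @ v) = foldr cancel_cons u (reduce v)"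
  by (simp add: reduce_def)

lemma reduce_append_reduce_left: "reduce (reduce u @ v) = reduce (u @ v)"
  by (simp add: reduce_append foldr_cancel_cons_reduce reduced_reduce)

lemma reduce_append_reduce_right: "reduce (u @ reduce v) = reduce (u @ v)"
  by (simp add: reduce_append reduce_reduced reduced_reduce)

lemma set_reduce_subset: "set (reduce w) \<subseteq> set w"
proof (induction w)
  case (Cons a w)
  have "set (cancel_cons a v) \<subseteq> insert a (set v)" for v
    by (cases v) auto
  then show ?case
    using Cons by (fastforce simp: reduce_def)
qed (simp add: reduce_def)

lemma reduce_rev_inv_letter_append:
  "reduced w \<Longrightarrow> reduce (rev (map inv_letter w) @ w) = []"
proof (induction w)
  case (Cons a w)
  have "reduced (a # w)" "reduced w"
    using Cons.prems by (auto simp: reduced_Cons)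
  then have "cancel_cons (inv_letter a) (reduce (a # w)) = reduce w"
    by (simp add: reduce_reduced)
  then show ?case
    using Cons.IH \<open>reduced w\<close> by (simp add: reduce_append) (simp add: reduce_def)
qed (simp add: reduce_def)

lemma reduced_rev_inv_letter: "reduced w \<Longrightarrow> reduced (rev (map inv_letter w))"
  unfolding reduced_def successively_rev successively_map
  by (erule successively_mono) (metis inv_letter_inv_letter)

lemma group_free_group: "group (free_group X)"
proof (rule groupI)
  fix u v assume "u \<in> carrier (free_group X)" "v \<in> carrier (free_group X)"
  then show "u \<otimes>\<^bsub>free_group X\<^esub> v \<in> carrier (free_group X)"
    using set_reduce_subset[of "u @ v"] by (auto simp: free_group_def reduced_reduce)
next
  fix u v w
  show "u \<otimes>\<^bsub>free_group X\<^esub> v \<otimes>\<^bsub>free_group X\<^esub> w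
      = u \<otimes>\<^bsub>free_group X\<^esub> (v \<otimes>\<^bsub>free_group X\<^esub> w)"
    by (simp add: free_group_def reduce_append_reduce_left reduce_append_reduce_right)
next
  fix w assume w: "w \<in> carrier (free_group X)"
  then show "\<one>\<^bsub>free_group X\<^esub> \<otimes>\<^bsub>free_group X\<^esub> w = w"
    by (simp add: free_group_def reduce_reduced)
  have "rev (map inv_letter w) \<in> carrier (free_group X)"
    using w by (auto simp: free_group_def reduced_rev_inv_letter inv_letter_def)
  moreover have "rev (map inv_letter w) \<otimes>\<^bsub>free_group X\<^esub> w = \<one>\<^bsub>free_group X\<^esub>"
    using w by (simp add: free_group_def reduce_rev_inv_letter_append)
  ultimately show "\<exists>v\<in>carrier (free_group X). v \<otimes>\<^bsub>free_group X\<^esub> w = \<one>\<^bsub>free_group X\<^esub>"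
    by blast
qed (simp add: free_group_def)

lemma inv_free_group:
  assumes "w \<in> carrier (free_group X)"
  shows "inv\<^bsub>free_group X\<^esub> w = rev (map inv_letter w)"
proof (rule group.inv_equality[OF group_free_group])
  show "rev (map inv_letter w) \<otimes>\<^bsub>free_group X\<^esub> w = \<one>\<^bsub>free_group X\<^esub>"
    using assms by (simp add: free_group_def reduce_rev_inv_letter_append)
  show "rev (map inv_letter w) \<in> carrier (free_group X)"
    using assms by (auto simp: free_group_def reduced_rev_inv_letter inv_letter_def)
qed fact

text \<open>The universal property, with \<open>X\<close> embedded by \<open>x \<mapsto> [(x, True)]\<close>.\<close>

lemma free_group_hom_exists:
  assumes "group G" and f: "f \<in> X \<rightarrow> carrier G"
  shows "\<exists>h\<in>hom (free_group X) G. \<forall>x\<in>X. h [(x, True)] = f x"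
proof -
  interpret group G by fact
  define l where "l a = (if snd a then f (fst a) else inv\<^bsub>G\<^esub> f (fst a))" for a
  define e where "e w = foldr (\<lambda>a y. l a \<otimes>\<^bsub>G\<^esub> y) w \<one>\<^bsub>G\<^esub>" for w
  have l: "l a \<in> carrier G" if "a \<in> X \<times> UNIV" for a
    using that f by (auto simp: l_def)
  have l_inv: "l (inv_letter a) = inv\<^bsub>G\<^esub> l a" if "a \<in> X \<times> UNIV" for a
    using that f by (cases a) (auto simp: l_def inv_letter_def Pi_iff)
  have e: "e w \<in> carrier G" if "set w \<subseteq> X \<times> UNIV" for w
    using that by (induction w) (auto simp: e_def intro!: l)
  have e_append: "e (u @ v) = e u \<otimes>\<^bsub>G\<^esub> e v"
    if "set u \<subseteq> X \<times> UNIV" "set v \<subseteq> X \<times> UNIV" for u v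
    using that(1)
  proof (induction u)
    case Nil
    then show ?case using e[OF that(2)] by (simp add: e_def)
  next
    case (Cons a u)
    then have "e (a # u @ v) = l a \<otimes>\<^bsub>G\<^esub> (e u \<otimes>\<^bsub>G\<^esub> e v)"
      by (simp add: e_def)
    also have "\<dots> = e (a # u) \<otimes>\<^bsub>G\<^esub> e v"
      using Cons.prems l[of a] e[of u] e[OF that(2)] by (simp add: m_assoc e_def)
    finally show ?case by simp
  qed
  have e_cancel: "e (cancel_cons a w) = l a \<otimes>\<^bsub>G\<^esub> e w"
    if "a \<in> X \<times> UNIV" "set w \<subseteq> X \<times> UNIV" for a w
  proof (cases w)
    case (Cons b v)
    show ?thesis
    proof (cases "b = inv_letter a")
      case True
      have "l a \<otimes>\<^bsub>G\<^esub> (inv\<^bsub>G\<^esub> l a \<otimes>\<^bsub>G\<^esub> e v) = e v"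
        using that Cons l[of a] e[of v] by (simp add: m_assoc[symmetric])
      then show ?thesis
        using True Cons l_inv[OF that(1)] by (simp add: e_def)
    qed (simp add: Cons e_def)
  qed (simp add: e_def)
  have e_reduce: "e (reduce w) = e w" if "set w \<subseteq> X \<times> UNIV" for w
    using that
  proof (induction w)
    case (Cons a w)
    then have "set (reduce w) \<subseteq> X \<times> UNIV"
      using set_reduce_subset[of w] by auto
    with Cons have "e (cancel_cons a (reduce w)) = l a \<otimes>\<^bsub>G\<^esub> e w"
      using e_cancel[of a "reduce w"] by simp
    then show ?case by (simp add: reduce_def e_def)
  qed (simp add: reduce_def)
  have "e \<in> hom (free_group X) G"
    using e by (auto intro!: homI simp: free_group_def e_reduce e_append)
  moreover have "\<forall>x\<in>X. e [(x, True)] = f x"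
    using f by (auto simp: e_def l_def Pi_iff)
  ultimately show ?thesis by blast
qed

lemma free_group_hom_unique:
  assumes "group G" and hom: "g \<in> hom (free_group X) G" "h \<in> hom (free_group X) G"
    and eq: "\<And>x. x \<in> X \<Longrightarrow> g [(x, True)] = h [(x, True)]"
    and w: "w \<in> carrier (free_group X)"
  shows "g w = h w"
proof -
  interpret g: group_hom "free_group X" G g
    by (simp add: group_hom_def group_hom_axioms_def group_free_group assms)
  interpret h: group_hom "free_group X" G h
    by (simp add: group_hom_def group_hom_axioms_def group_free_group assms)
  have letter: "g [a] = h [a]" if a_in: "a \<in> X \<times> UNIV" for a
  proof -
    obtain x b where a: "a = (x, b)" "x \<in> X" using a_in by auto
    have c: "[(x, True)] \<in> carrier (free_group X)"
      using a by (simp add: free_group_def reduced_Cons)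
    have "inv\<^bsub>free_group X\<^esub> [(x, True)] = [(x, False)]"
      using inv_free_group[OF c] by (simp add: inv_letter_def)
    then have "g [(x, False)] = h [(x, False)]"
      using g.hom_inv[OF c] h.hom_inv[OF c] eq[OF a(2)] by simp
    then show ?thesis using a eq by (cases b) auto
  qed
  show ?thesis
    using w
  proof (induction w)
    case Nil
    then show ?case
      using g.hom_one h.hom_one by (simp add: free_group_def)
  next
    case (Cons a w)
    then have aw: "[a] \<in> carrier (free_group X)" "w \<in> carrier (free_group X)"
      by (auto simp: free_group_def reduced_Cons)
    have "a # w = [a] \<otimes>\<^bsub>free_group X\<^esub> w"
      using Cons.prems by (simp add: free_group_def reduce_reduced)
    then show ?case
      using Cons.IH Cons.prems aw letter[of a] g.hom_mult[OF aw] h.hom_mult[OF aw]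
      by (auto simp: free_group_def)
  qed
qed

end

theory Submission
  imports Defs
begin

text \<open>
  An endomorphism is the tuple \<open>A\<close> of its values on the generators; its image is non-cyclic exactly
  when two entries of \<open>A\<close> do not commute. The entries act on the Cayley tree of the free group, and
  everything is measured by displacements of vertices in that tree. Two words \<open>c\<close> and \<open>u\<close> are built
  such that the values \<open>c(A)\<close> and \<open>u(A)\<close> recover \<open>A\<close>.

  The word \<open>c\<close> is a ruler: for every tuple \<open>A\<close> with non-commuting entries, \<open>c(A)\<close> is nontrivial, and some
  vertex of the tree is moved by no entry of \<open>A\<close> further than a constant times the translation length
  of \<open>c(A)\<close>, the constant being the same for all tuples (\<open>controlling_word\<close>). At a vertex where the largest
  displacement is as small as possible, an entry or a product of two entries translates by a comparable
  amount, up to an additive constant (\<open>exists_basepoint\<close>). If \<open>g\<close> and \<open>h\<close> do not commute, the commutator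
  \<open>[g^30, h]\<close> translates at least as far as \<open>g\<close> (\<open>ell_le_commutator\<close>), so for each tuple one of finitely
  many commutator words does what is wanted. These words are merged, two at a time, into one word \<open>v^p w^q\<close>. If the two values do not
  commute, their axes share only a short segment, so that high powers cannot cancel
  (\<open>max_ell_le_product_of_powers\<close>). If they commute, they are powers of one element, and the exponents
  are bounded independently of \<open>A\<close>: on the values of a fixed product of commutators a counting
  quasimorphism is bounded, but on the powers of the root it grows with the exponent (\<open>balanced_root_bound\<close>). Hence suitable \<open>p\<close> and
  \<open>q\<close> rule out cancellation in this case as well.

  If \<open>c(A) = c(B) = C\<close>, then long powers of \<open>C\<close> serve as marks common to both tuples. With
  \<open>d = x\<^sub>1 c^M x\<^sub>2 c^M \<dots> x\<^sub>m c^M\<close>, whose value \<open>D\<close> never commutes with \<open>C\<close> (\<open>spread_not_commute\<close>), the word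
  \<open>u = d c^N d c^N x\<^sub>1 c^N d c^N x\<^sub>2 c^N d \<dots> x\<^sub>m c^N d\<close> can be read from left to right. A path that
  runs along a long piece of the axis of \<open>C\<close> determines the preceding factor up to right multiplication
  by an element of the centralizer of \<open>C\<close> (\<open>peel_first_factor\<close>), and the next factor \<open>D\<close> leaves no room for
  such an element, because centralizers are malnormal (\<open>separated_product_inj\<close>).

  The good vertices for \<open>A\<close> and for \<open>B\<close> may be far apart on the axis of \<open>C\<close>, as \<open>A\<close> and \<open>C A C\<^sup>-\<^sup>1\<close> have
  the same value under \<open>c\<close>. Bringing both near one vertex turns \<open>u(A) = u(B)\<close> into an equation up to
  conjugation by some \<open>C^s\<close>. Since the path to \<open>u(A)\<close> leaves the axis of \<open>C\<close> soon, \<open>s\<close> is bounded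
  independently of \<open>N\<close>, and the conjugation can be absorbed (\<open>separated_product_inj_up_to_conj\<close>).
\<close>

section \<open>Groups in multiplicative notation\<close>

class mult_group = monoid_mult + inverse +
  assumes inverse_mult_self [simp]: "inverse a * a = 1"
    and divide_eq_mult_inverse: "a / b = a * inverse b"
begin

lemma inverse_mult_cancel [simp]: "inverse a * (a * b) = b"
  by (simp flip: mult.assoc)

lemma left_cancel [simp]: "a * b = a * c \<longleftrightarrow> b = c"
  by (metis inverse_mult_cancel)

lemma mult_inverse_self [simp]: "a * inverse a = 1"
proof -
  have "inverse a * (a * inverse a) = inverse a * 1" by simp
  then show ?thesis by (simp only: left_cancel)
qed

lemma mult_inverse_cancel [simp]: "a * (inverse a * b) = b"
  by (simp flip: mult.assoc)

lemma right_cancel [simp]: "b * a = c * a \<longleftrightarrow> b = c"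
  by (metis mult.assoc mult_1_right mult_inverse_self)

lemma inverse_unique_group: "a * b = 1 \<Longrightarrow> inverse a = b"
  by (metis inverse_mult_cancel mult_1_right)

lemma inverse_inverse_group [simp]: "inverse (inverse a) = a"
  by (rule inverse_unique_group) simp

lemma inverse_one_group [simp]: "inverse 1 = 1"
  by (rule inverse_unique_group) simp

lemma inverse_mult_group [simp]: "inverse (a * b) = inverse b * inverse a"
  by (rule inverse_unique_group) (simp add: mult.assoc)

lemma inverse_eq_iff_group [simp]: "inverse a = inverse b \<longleftrightarrow> a = b"
  by (metis inverse_inverse_group)

lemma inverse_eq_one_group [simp]: "inverse a = 1 \<longleftrightarrow> a = 1"
  by (metis inverse_inverse_group inverse_one_group)

lemma inverse_power_group: "inverse (a ^ n) = inverse a ^ n"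
  by (induction n) (simp_all add: power_Suc2 power_Suc del: power_Suc, simp add: power_commutes)

lemma conj_power: "(x * a * inverse x) ^ n = x * a ^ n * inverse x"
  by (induction n) (simp_all add: mult.assoc)

end

lemma powi_add_1: "(a :: 'a :: mult_group) powi (n + 1) = a powi n * a"
proof (cases "n \<ge> 0")
  case True
  then show ?thesis
    by (simp add: power_int_def nat_add_distrib power_Suc2 del: power_Suc)
next
  case False
  then have "nat (- n) = Suc (nat (- (n + 1)))" by simp
  with False show ?thesis
    by (auto simp: power_int_def power_Suc2 mult.assoc simp del: power_Suc)
qed

lemma powi_diff_1: "(a :: 'a :: mult_group) powi (n - 1) = a powi n * inverse a"
  using powi_add_1[of a "n - 1"] by (simp add: mult.assoc)

lemma powi_add: "(a :: 'a :: mult_group) powi (m + n) = a powi m * a powi n"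
proof (induction n rule: int_induct[where k = 0])
  case (step1 i)
  then show ?case by (simp add: powi_add_1 mult.assoc flip: add.assoc)
next
  case (step2 i)
  have "a powi (m + (i - 1)) = a powi (m + i) * inverse a"
    using powi_diff_1[of a "m + i"] by (simp add: algebra_simps)
  then show ?case by (simp add: step2 powi_diff_1 mult.assoc)
qed simp

lemma powi_minus: "(a :: 'a :: mult_group) powi (- n) = inverse (a powi n)"
  using powi_add[of a n "- n"] inverse_unique_group[of "a powi n" "a powi (- n)"] by simp

lemma powi_mult: "(a :: 'a :: mult_group) powi (m * n) = (a powi m) powi n"
proof (induction n rule: int_induct[where k = 0])
  case (step1 i)
  then show ?case by (simp add: powi_add distrib_left)
next
  case (step2 i)
  have "m * (i - 1) = m * i + - m" by (simp add: algebra_simps)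
  then show ?case by (simp only: step2 powi_add powi_diff_1 powi_minus)
qed simp

section \<open>Free groups as metric trees\<close>

text \<open>
  Every tuple takes its values in the free group on all of \<open>'a\<close>, so that group elements form a type;
  the subgroup on a set \<open>X\<close> of generators reappears only as a condition on letters.
\<close>

typedef 'a fgroup = "{w :: 'a letter list. reduced w}"
  morphisms word fgroup_of
  by (rule exI[of _ "[]"]) simp

setup_lifting type_definition_fgroup

instantiation fgroup :: (type) mult_group
begin

lift_definition one_fgroup :: "'a fgroup" is "[]" by simp

lift_definition times_fgroup :: "'a fgroup \<Rightarrow> 'a fgroup \<Rightarrow> 'a fgroup"
  is "\<lambda>u v. reduce (u @ v)"
  by (simp add: reduced_reduce)

lift_definition inverse_fgroup :: "'a fgroup \<Rightarrow> 'a fgroup" is "\<lambda>u. rev (map inv_letter u)"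
  by (simp add: reduced_rev_inv_letter)

definition divide_fgroup :: "'a fgroup \<Rightarrow> 'a fgroup \<Rightarrow> 'a fgroup"
  where "divide_fgroup a b = a * inverse b"

instance
proof
  fix a b c :: "'a fgroup"
  show "a * b * c = a * (b * c)"
    by transfer (simp add: reduce_append_reduce_left reduce_append_reduce_right)
  show "1 * a = a" "a * 1 = a"
    by (transfer, simp add: reduce_reduced)+
  show "inverse a * a = 1"
    by transfer (simp add: reduce_rev_inv_letter_append)
qed (rule divide_fgroup_def)

end

lemma reduced_word [simp]: "reduced (word x)"
  using word[of x] by simp

definition len :: "'a fgroup \<Rightarrow> nat" where
  "len x = length (word x)"

fun lcp :: "'b list \<Rightarrow> 'b list \<Rightarrow> nat" where
  "lcp (a # u) (b # v) = (if a = b then Suc (lcp u v) else 0)"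
| "lcp u v = 0"

text \<open>
  The Gromov product at the vertex \<open>1\<close> of the Cayley tree: the paths from \<open>1\<close> to \<open>x\<close> and from \<open>1\<close> to \<open>y\<close>
  run together for \<open>gp x y\<close> steps. The geometry below rests on the distance formula \<open>len_gp\<close>, the inequality
  \<open>gp_ultrametric\<close>, which says that the Cayley graph is a tree, and the existence of prefixes.
\<close>

definition gp :: "'a fgroup \<Rightarrow> 'a fgroup \<Rightarrow> nat" where
  "gp x y = lcp (word x) (word y)"

lemma lcp_commute: "lcp u v = lcp v u"
  by (induction u v rule: lcp.induct) auto

lemma lcp_le: "lcp u v \<le> length u"
  by (induction u v rule: lcp.induct) auto

lemma lcp_ultrametric: "lcp u w \<ge> min (lcp u v) (lcp v w)"
proof (induction u v arbitrary: w rule: lcp.induct)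
  case (1 a u b v)
  then show ?case by (cases w) (fastforce simp: min_le_iff_disj)+
qed auto

lemma lcp_take: "lcp (take k u) u = min k (length u)"
  by (induction u arbitrary: k) (auto simp: take_Cons')

lemma lcp_nth: "i < lcp u v \<Longrightarrow> u ! i = v ! i"
proof (induction u v arbitrary: i rule: lcp.induct)
  case (1 a u b v)
  then show ?case by (cases i) (auto split: if_splits)
qed auto

lemma reduced_append:
  "reduced (u @ v) \<longleftrightarrow> reduced u \<and> reduced v \<and> (u = [] \<or> v = [] \<or> hd v \<noteq> inv_letter (last u))"
  by (auto simp: reduced_def successively_append_iff)

lemma inv_letter_eq_iff [simp]: "inv_letter a = inv_letter b \<longleftrightarrow> a = b"
  by (metis inv_letter_inv_letter)

lemma take_lcp_eq: "take (lcp u v) u = take (lcp u v) v"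
  by (induction u v rule: lcp.induct) auto

text \<open>
  In a product of two reduced words, exactly the common prefix of the second and the inverse of the
  first cancels.
\<close>

lemma reduce_inverse_append:
  assumes "reduced u" "reduced v"
  shows "reduce (rev (map inv_letter u) @ v)
    = rev (map inv_letter (drop (lcp u v) u)) @ drop (lcp u v) v"
  using assms
proof (induction u v rule: lcp.induct)
  case (1 a u b v)
  have red: "reduced u" "reduced v"
    using 1 by (auto simp: reduced_Cons)
  show ?case
  proof (cases "a = b")
    case True
    have "reduce (inv_letter a # b # v) = v"
      using True 1 red by (auto simp: reduce_reduced[unfolded reduce_def] reduce_def)
        (simp add: cancel_cons_reduced)
    then have "reduce (rev (map inv_letter (a # u)) @ b # v) = reduce (rev (map inv_letter u) @ v)"
      by (metis append.assoc append_Cons append_Nil list.simps(9) reduce_append_reduce_right rev.simps(2))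
    then show ?thesis
      using 1 True red by simp
  next
    case False
    have "reduced (rev (map inv_letter (a # u)) @ b # v)"
      unfolding reduced_append
      using 1 False reduced_rev_inv_letter[of "a # u"] by (auto simp: last_rev)
    then show ?thesis using False by (simp add: reduce_reduced)
  qed
next
  case ("2_1" v)
  then show ?case by (simp add: reduce_reduced)
next
  case ("2_2" u)
  then show ?case
    by (simp add: reduce_reduced reduced_rev_inv_letter del: rev.simps)
qed

lemma length_reduce_lcp:
  assumes "reduced u" "reduced v"
  shows "length (reduce (rev (map inv_letter u) @ v)) + 2 * lcp u v = length u + length v"
  using reduce_inverse_append[OF assms] lcp_le[of u v] lcp_le[of v u] by (simp add: lcp_commute)

lemma len_gp: "len (inverse x * y) + 2 * gp x y = len x + len y"
  unfolding len_def gp_def by transfer (simp add: length_reduce_lcp)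

lemma gp_commute: "gp x y = gp y x"
  by (simp add: gp_def lcp_commute)

lemma gp_le1 [simp]: "gp x y \<le> len x"
  by (simp add: gp_def len_def lcp_le)

lemma gp_le2 [simp]: "gp x y \<le> len y"
  by (metis gp_commute gp_le1)

lemma gp_ultrametric: "min (gp x y) (gp y z) \<le> gp x z"
  using lcp_ultrametric by (simp add: gp_def)

lemma len_one [simp]: "len 1 = 0"
  by (simp add: len_def one_fgroup.rep_eq)

lemma len_eq_0 [simp]: "len x = 0 \<longleftrightarrow> x = 1"
  by (simp add: len_def) (metis one_fgroup.rep_eq word_inject)

lemma len_inverse [simp]: "len (inverse x) = len x"
  by (simp add: len_def inverse_fgroup.rep_eq)

lemma len_mult: "len (x * y) + 2 * gp (inverse x) y = len x + len y"
  using len_gp[of "inverse x" y] by simp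

lemma gp_self [simp]: "gp x x = len x"
  using len_gp[of x x] by simp

lemma gp_one [simp]: "gp 1 x = 0" "gp x 1 = 0"
  by (simp_all add: gp_def one_fgroup.rep_eq)

lemma exists_prefix:
  assumes "k \<le> len x"
  obtains u where "len u = k" "gp u x = k"
proof
  have "reduced (take k (word x))"
    by (metis append_take_drop_id reduced_append reduced_word)
  then have w: "word (fgroup_of (take k (word x))) = take k (word x)"
    by (simp add: fgroup_of_inverse)
  show "len (fgroup_of (take k (word x))) = k"
    using assms by (simp add: len_def w)
  show "gp (fgroup_of (take k (word x))) x = k"
    using assms by (simp add: gp_def w lcp_take len_def)
qed

lemma eq_of_gp: "len x \<le> gp x y \<Longrightarrow> len y \<le> gp x y \<Longrightarrow> x = y"
proof -
  assume "len x \<le> gp x y" "len y \<le> gp x y"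
  then have "len (inverse x * y) = 0"
    using len_gp[of x y] by linarith
  then have "inverse x * y = 1" by simp
  then show "x = y" using inverse_unique_group by fastforce
qed

text \<open>
  If a word and its inverse agreed up to the middle, then the middle letter would be its own inverse,
  or the two middle letters would cancel. This is where the absence of torsion enters.
\<close>

lemma two_gp_inverse_less:
  assumes "x \<noteq> 1"
  shows "2 * gp x (inverse x) < len x"
proof (rule ccontr)
  define n where "n = len x"
  assume "\<not> ?thesis"
  then have p: "n \<le> 2 * gp x (inverse x)" by (simp add: n_def)
  have n: "n > 0" using assms by (metis len_eq_0 n_def neq0_conv)
  have sym: "word x ! i = inv_letter (word x ! (n - 1 - i))" if "i < gp x (inverse x)" for i
  proof -
    have "i < n" using that gp_le1[of x "inverse x"] n_def by linarith
    then have "word (inverse x) ! i = inv_letter (word x ! (n - 1 - i))"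
      by (simp add: inverse_fgroup.rep_eq rev_nth n_def len_def)
    then show ?thesis
      using lcp_nth[of i "word x" "word (inverse x)"] that by (simp add: gp_def)
  qed
  show False
  proof (cases "even n")
    case True
    then obtain k where k: "n = 2 * k" by blast
    then have "k - 1 < gp x (inverse x)" using p n by linarith
    from sym[OF this] have "word x ! (k - 1) = inv_letter (word x ! Suc (k - 1))"
      using k n by (simp add: mult_2)
    moreover have "word x ! Suc (k - 1) \<noteq> inv_letter (word x ! (k - 1))"
      using successively_nth[of "\<lambda>a b. b \<noteq> inv_letter a" "word x" "k - 1"] reduced_word[of x] k n
      by (auto simp: reduced_def n_def len_def)
    ultimately show False by simp
  next
    case False
    then obtain k where k: "n = Suc (2 * k)" by (metis oddE Suc_eq_plus1)
    then have "k < gp x (inverse x)" using p by linarith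
    from sym[OF this] have "word x ! k = inv_letter (word x ! k)"
      using k by (simp add: mult_2)
    then show False by (simp add: inv_letter_def prod_eq_iff)
  qed
qed

section \<open>Powers, translation length and centralizers\<close>

lemma gp_left: "gp x (x * y) + gp (inverse x) y = len x"
  using len_gp[of x "x * y"] len_mult[of x y] by simp

lemma len_mult_le: "len (x * y) \<le> len x + len y"
  using len_mult[of x y] by linarith

lemma len_power_le: "len (x ^ n) \<le> n * len x"
  by (induction n) (auto intro: order_trans[OF len_mult_le])

text \<open>
  Each new factor \<open>g\<close> cancels no more than \<open>g\<close> cancels against itself: by \<open>two_gp_inverse_less\<close> the first
  letters of \<open>g^n\<close> are those of \<open>g\<close>, past the point up to which \<open>g\<close> and its inverse agree.
\<close>

lemma gp_power_aux:
  assumes "g \<noteq> 1"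
  shows "len g \<le> gp g (g ^ Suc n) + gp g (inverse g)
    \<and> Suc n * len g \<le> len (g ^ Suc n) + 2 * n * gp g (inverse g)"
proof (induction n)
  case (Suc n)
  define p where "p = gp g (inverse g)"
  have p: "2 * p < len g"
    using two_gp_inverse_less[OF assms] by (simp add: p_def)
  have "min (gp g (g ^ Suc n)) (gp (g ^ Suc n) (inverse g)) \<le> p"
    unfolding p_def by (rule gp_ultrametric)
  then have le: "gp (inverse g) (g ^ Suc n) \<le> p"
    using Suc p by (simp add: p_def gp_commute[of _ "inverse g"] min_le_iff_disj del: power_Suc)
  have "len (g * g ^ Suc n) + 2 * p \<ge> len g + len (g ^ Suc n)"
    using len_mult[of g "g ^ Suc n"] le by linarith
  then have "Suc (Suc n) * len g \<le> len (g * g ^ Suc n) + 2 * Suc n * p"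
    using Suc by (simp add: p_def algebra_simps)
  moreover have "len g \<le> gp g (g * g ^ Suc n) + p"
    using gp_left[of g "g ^ Suc n"] le by linarith
  ultimately show ?case by (simp add: p_def del: mult_Suc)
qed simp

text \<open>
  Geometrically, for \<open>g \<noteq> 1\<close>: the axis of \<open>g\<close> passes through the vertex \<open>1\<close>.
\<close>

definition cyc_reduced :: "'a fgroup \<Rightarrow> bool" where
  "cyc_reduced g \<longleftrightarrow> gp g (inverse g) = 0"

lemma cyc_reduced_inverse [simp]: "cyc_reduced (inverse g) \<longleftrightarrow> cyc_reduced g"
  by (simp add: cyc_reduced_def gp_commute)

lemma len_power_cyc_reduced:
  assumes "cyc_reduced g"
  shows "len (g ^ n) = n * len g"
proof (cases "g = 1 \<or> n = 0")
  case False
  then obtain k where "n = Suc k" by (cases n) auto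
  then have "n * len g \<le> len (g ^ n)"
    using gp_power_aux[of g k] False assms by (simp add: cyc_reduced_def del: power_Suc)
  then show ?thesis using len_power_le[of g n] by linarith
qed auto

lemma cyc_reduced_power:
  assumes "cyc_reduced g"
  shows "cyc_reduced (g ^ n)"
proof -
  have "g ^ n * g ^ n = g ^ (n + n)" by (simp add: power_add)
  then have "len (g ^ n * g ^ n) = len (g ^ n) + len (g ^ n)"
    using assms by (simp add: len_power_cyc_reduced algebra_simps)
  then show ?thesis
    using len_mult[of "g ^ n" "g ^ n"] by (simp add: cyc_reduced_def gp_commute)
qed

text \<open>
  The translation length. Defined as the least length in the conjugacy class, it is invariant under
  conjugation by construction; \<open>len_le_ell\<close> computes it up to cancellation.
\<close>

definition ell :: "'a fgroup \<Rightarrow> nat" where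
  "ell g = (LEAST n. \<exists>x. n = len (x * g * inverse x))"

lemma ell_attained: "\<exists>x. len (x * g * inverse x) = ell g"
proof -
  have "\<exists>x. ell g = len (x * g * inverse x)"
    unfolding ell_def by (rule LeastI_ex) blast
  then show ?thesis by metis
qed

lemma ell_le_conj: "ell g \<le> len (x * g * inverse x)"
  unfolding ell_def by (rule Least_le) blast

lemma ell_le: "ell g \<le> len g"
  using ell_le_conj[of g 1] by simp

lemma ell_conj [simp]: "ell (y * g * inverse y) = ell g"
proof (rule antisym)
  obtain x where "len (x * g * inverse x) = ell g" using ell_attained by blast
  moreover have "ell (y * g * inverse y)
      \<le> len ((x * inverse y) * (y * g * inverse y) * inverse (x * inverse y))"
    by (rule ell_le_conj)
  ultimately show "ell (y * g * inverse y) \<le> ell g" by (simp add: mult.assoc)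
next
  obtain x where "len (x * (y * g * inverse y) * inverse x) = ell (y * g * inverse y)"
    using ell_attained by blast
  moreover have "ell g \<le> len ((x * y) * g * inverse (x * y))"
    by (rule ell_le_conj)
  ultimately show "ell g \<le> ell (y * g * inverse y)" by (simp add: mult.assoc)
qed

lemma ell_conj' [simp]: "ell (inverse y * g * y) = ell g"
  using ell_conj[of "inverse y" g] by simp

lemma ell_mult_commute: "ell (x * y) = ell (y * x)"
  using ell_conj[of y "x * y"] by (simp add: mult.assoc)

text \<open>
  Compare the growth of \<open>g^n\<close> with that of the powers of a shortest conjugate: the conjugating element
  changes lengths by a bounded amount only, so the rates of growth must agree.
\<close>

lemma len_le_ell: "len g \<le> ell g + 2 * gp g (inverse g)"
proof (cases "g = 1")
  case False
  define p where "p = gp g (inverse g)"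
  obtain x where x: "len (x * g * inverse x) = ell g" using ell_attained by blast
  define n where "n = 2 * len x"
  have "Suc n * len g \<le> len (g ^ Suc n) + 2 * n * p"
    using gp_power_aux[OF False, of n] by (simp add: p_def del: power_Suc)
  moreover have "len (g ^ Suc n) \<le> n + Suc n * ell g"
  proof -
    have eq: "g ^ Suc n = inverse x * (x * g * inverse x) ^ Suc n * x"
      by (simp only: conj_power) (simp add: mult.assoc)
    have "len (inverse x * (x * g * inverse x) ^ Suc n * x) \<le> len (inverse x) + len ((x * g * inverse x) ^ Suc n) + len x"
      using len_mult_le[of "inverse x" "(x * g * inverse x) ^ Suc n"]
        len_mult_le[of "inverse x * (x * g * inverse x) ^ Suc n" x] by linarith
    then have "len (g ^ Suc n) \<le> len (inverse x) + len ((x * g * inverse x) ^ Suc n) + len x"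
      by (simp only: eq[symmetric])
    moreover have "len ((x * g * inverse x) ^ Suc n) \<le> Suc n * ell g"
      using len_power_le[of "x * g * inverse x" "Suc n"] by (simp only: x)
    ultimately show ?thesis unfolding n_def len_inverse by linarith
  qed
  ultimately have "Suc n * len g \<le> n + Suc n * ell g + 2 * n * p" by linarith
  also have "\<dots> < Suc n * (ell g + 2 * p + 1)" by (simp add: algebra_simps)
  finally have "len g < ell g + 2 * p + 1" by (simp only: mult_less_cancel1)
  then show ?thesis by (simp add: p_def)
qed simp

lemma shorten_by_conj:
  obtains u where "len (inverse u * g * u) + 2 * gp g (inverse g) \<le> len g"
proof (cases "g = 1")
  case True
  then show ?thesis using that[of 1] by simp
next
  case False
  define p where "p = gp g (inverse g)"
  have p: "2 * p < len g" using two_gp_inverse_less[OF False] by (simp add: p_def)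
  then obtain u where u: "len u = p" "gp u g = p"
    using exists_prefix[of p g] by auto
  have "min (gp u g) (gp g (inverse g)) \<le> gp u (inverse g)" by (rule gp_ultrametric)
  then have "gp u (inverse g) = p"
    using u gp_le1[of u "inverse g"] by (simp add: p_def)
  then have gu: "gp (inverse g) u = p" by (simp add: gp_commute)
  have "min (gp u g) (gp g (g * u)) \<le> gp u (g * u)" by (rule gp_ultrametric)
  then have "p \<le> gp u (g * u)"
    using gp_left[of g u] u p gu by simp
  then have "len (inverse u * (g * u)) + 2 * p \<le> len g"
    using len_gp[of u "g * u"] len_mult[of g u] u gu by linarith
  then show ?thesis using that[of u] by (simp add: p_def mult.assoc)
qed

lemma cyc_reduced_iff_ell: "cyc_reduced g \<longleftrightarrow> len g = ell g"
proof
  assume "cyc_reduced g"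
  then show "len g = ell g"
    using len_le_ell[of g] ell_le[of g] by (simp add: cyc_reduced_def)
next
  assume len: "len g = ell g"
  obtain u where "len (inverse u * g * u) + 2 * gp g (inverse g) \<le> len g"
    by (rule shorten_by_conj)
  moreover have "ell g \<le> len (inverse u * g * u)"
    using ell_le_conj[of g "inverse u"] by simp
  ultimately show "cyc_reduced g" using len by (simp add: cyc_reduced_def)
qed

lemma exists_cyc_reduced_conj: "\<exists>x. cyc_reduced (x * g * inverse x)"
  using ell_attained[of g] by (auto simp: cyc_reduced_iff_ell)

lemma ell_power [simp]: "ell (g ^ n) = n * ell g"
proof -
  obtain x where x: "cyc_reduced (x * g * inverse x)" using exists_cyc_reduced_conj by blast
  define u where "u = x * g * inverse x"
  have u: "cyc_reduced u" using x by (simp only: u_def)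
  have "ell (g ^ n) = ell (u ^ n)" by (simp only: u_def conj_power ell_conj)
  also have "\<dots> = len (u ^ n)" by (rule sym, rule cyc_reduced_iff_ell[THEN iffD1], rule cyc_reduced_power, rule u)
  also have "\<dots> = n * len u" by (rule len_power_cyc_reduced, rule u)
  also have "len u = ell u" by (rule cyc_reduced_iff_ell[THEN iffD1], rule u)
  also have "\<dots> = ell g" by (simp only: u_def ell_conj)
  finally show ?thesis .
qed

lemma ell_one [simp]: "ell 1 = 0"
  using ell_le[of 1] by simp

lemma ell_eq_0 [simp]: "ell g = 0 \<longleftrightarrow> g = 1"
proof
  assume "ell g = 0"
  then obtain x where "x * g * inverse x = 1" using ell_attained[of g] by auto
  then have "inverse x * (x * g * inverse x) * x = 1" by simp
  then show "g = 1" by (simp add: mult.assoc)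
qed simp

lemma ell_inverse [simp]: "ell (inverse g) = ell g"
proof -
  obtain x where x: "cyc_reduced (x * g * inverse x)" using exists_cyc_reduced_conj by blast
  then have "cyc_reduced (inverse (x * g * inverse x))" by (simp only: cyc_reduced_inverse)
  then have "ell (inverse (x * g * inverse x)) = ell (x * g * inverse x)"
    using x unfolding cyc_reduced_iff_ell by (metis len_inverse)
  then show ?thesis
    using ell_conj[of x "inverse g"] ell_conj[of x g] by (simp add: mult.assoc del: ell_conj)
qed

lemma ell_powi [simp]: "ell (g powi i) = nat \<bar>i\<bar> * ell g"
proof (cases "i \<ge> 0")
  case False
  then have "ell (g powi i) = nat (- i) * ell (inverse g)"
    by (simp only: power_int_def if_False ell_power)
  then show ?thesis using False by simp
qed (simp add: power_int_def)

lemma power_eq_one_iff_group [simp]: "g ^ n = 1 \<longleftrightarrow> g = 1 \<or> n = 0" for g :: "'a fgroup"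
  by (metis ell_eq_0 ell_power mult_is_0)

lemma powi_eq_one_iff [simp]: "g powi i = 1 \<longleftrightarrow> g = 1 \<or> i = 0" for g :: "'a fgroup"
  by (metis abs_0 ell_eq_0 ell_powi mult_is_0 nat_zero_as_int zero_less_abs_iff zero_less_nat_eq less_irrefl)

lemma conj_powi: "(x * a * inverse x) powi k = x * a powi k * inverse x" for a :: "'a :: mult_group"
  using conj_power[of x a] conj_power[of x "inverse a"]
  by (simp add: power_int_def mult.assoc)

subsection \<open>Uniqueness of roots\<close>

lemma cyc_reduced_of_power:
  assumes "cyc_reduced (g ^ n)" "n > 0"
  shows "cyc_reduced g"
proof (cases "g = 1")
  case False
  obtain k where n: "n = Suc k" using assms(2) by (cases n) auto
  define p where "p = gp g (inverse g)"
  have p: "2 * p < len g" using two_gp_inverse_less[OF False] by (simp add: p_def)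
  have 1: "len g \<le> gp g (g ^ n) + p"
    using gp_power_aux[OF False, of k] by (simp add: n p_def del: power_Suc)
  have 2: "len g \<le> gp (inverse g) (inverse g ^ n) + p"
    using gp_power_aux[of "inverse g" k] False by (simp add: n p_def gp_commute del: power_Suc)
  have "min (gp (g ^ n) g) (gp g (inverse g)) \<le> gp (g ^ n) (inverse g)"
    by (rule gp_ultrametric)
  moreover have "min (gp (g ^ n) (inverse g)) (gp (inverse g) (inverse g ^ n))
      \<le> gp (g ^ n) (inverse g ^ n)"
    by (rule gp_ultrametric)
  moreover have "gp (g ^ n) (inverse g ^ n) = 0"
    using assms(1) by (simp add: cyc_reduced_def inverse_power_group)
  ultimately have "p = 0"
    using p 1 2 by (simp add: p_def[symmetric] gp_commute[of "g ^ n" g] min_le_iff_disj)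
  then show ?thesis by (simp add: p_def cyc_reduced_def)
qed (simp add: cyc_reduced_def)

text \<open>
  After a conjugation \<open>x\<close> is cyclically reduced, hence so is \<open>y\<close>, and both are the prefix of the same
  length of the common power.
\<close>

lemma power_inj_group:
  assumes "x ^ n = y ^ n" "n > 0"
  shows "x = (y :: 'a fgroup)"
proof -
  obtain z where z: "cyc_reduced (z * x * inverse z)" using exists_cyc_reduced_conj by blast
  define u v where "u = z * x * inverse z" and "v = z * y * inverse z"
  have uv: "u ^ n = v ^ n" by (simp add: u_def v_def conj_power assms)
  have u: "cyc_reduced u" using z by (simp add: u_def)
  then have v: "cyc_reduced v" using cyc_reduced_power[OF u, of n] cyc_reduced_of_power[of v n] uv assms(2) by simp
  have "n * len u = n * len v" using len_power_cyc_reduced u v uv by metis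
  then have len: "len u = len v" using assms(2) by simp
  obtain k where n: "n = Suc k" using assms(2) by (cases n) auto
  have "len u \<le> gp u (u ^ n)" "len v \<le> gp v (v ^ n)"
    using gp_power_aux[of u k] gp_power_aux[of v k] u v by (cases "u = 1"; cases "v = 1"; simp add: cyc_reduced_def n)+
  moreover have "min (gp u (u ^ n)) (gp (u ^ n) v) \<le> gp u v" by (rule gp_ultrametric)
  ultimately have "len u \<le> gp u v" using len uv by (simp add: gp_commute)
  then have "u = v" using len by (simp add: eq_of_gp)
  then show ?thesis by (simp add: u_def v_def)
qed

subsection \<open>Commuting elements\<close>

definition commute :: "'a :: mult_group \<Rightarrow> 'a \<Rightarrow> bool" where
  "commute x y \<longleftrightarrow> x * y = y * x"

lemma commute_sym: "commute x y \<Longrightarrow> commute y x"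
  by (simp add: commute_def)

lemma commute_refl [simp]: "commute x x"
  by (simp add: commute_def)

lemma commute_one [simp]: "commute 1 x" "commute x 1"
  by (simp_all add: commute_def)

lemma commute_mult: "commute x y \<Longrightarrow> commute x z \<Longrightarrow> commute x (y * z)"
  unfolding commute_def by (metis mult.assoc)

lemma commute_inverse: "commute x y \<Longrightarrow> commute x (inverse y)"
  unfolding commute_def
  by (metis mult.assoc mult_1_left mult_1_right inverse_mult_self mult_inverse_self)

lemma commute_inverse_iff [simp]: "commute x (inverse y) \<longleftrightarrow> commute x y"
  "commute (inverse x) y \<longleftrightarrow> commute x y"
  by (metis commute_inverse commute_sym inverse_inverse_group)+

lemma commute_power: "commute x y \<Longrightarrow> commute x (y ^ n)"
  by (induction n) (simp_all add: commute_mult)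

lemma commute_powi: "commute x y \<Longrightarrow> commute x (y powi n)"
  by (simp add: power_int_def commute_power)

lemma commute_conj [simp]:
  "commute (x * a * inverse x) (x * b * inverse x) \<longleftrightarrow> commute a b"
  by (simp add: commute_def mult.assoc) (simp flip: mult.assoc)

lemma commute_iff_conj: "commute x y \<longleftrightarrow> x * y * inverse x = y"
  unfolding commute_def by (metis mult.assoc mult_1_right mult_inverse_self inverse_mult_self)

lemma commute_of_power:
  assumes "commute x (y ^ n)" "n > 0"
  shows "commute x (y :: 'a fgroup)"
proof -
  have "(x * y * inverse x) ^ n = y ^ n"
    using assms(1) by (simp add: conj_power commute_iff_conj)
  then show ?thesis using power_inj_group assms(2) by (simp add: commute_iff_conj) blast
qed

lemma commute_of_powi:
  assumes "commute x (y powi n)" "n \<noteq> 0"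
  shows "commute x (y :: 'a fgroup)"
  using assms commute_of_power[of x y "nat n"] commute_of_power[of x "inverse y" "nat (- n)"]
  by (auto simp: power_int_def split: if_splits)

lemma len_conj_cyc_reduced:
  assumes "cyc_reduced x" "gp x y < len x" "gp (inverse x) y = 0"
  shows "2 * len y + len x \<le> len (inverse y * x * y) + 2 * gp x y"
proof -
  have "min (gp x (x * y)) (gp (x * y) y) \<le> gp x y" by (rule gp_ultrametric)
  then have "gp (x * y) y \<le> gp x y"
    using gp_left[of x y] assms by simp
  then show ?thesis
    using len_gp[of y "x * y"] len_mult[of x y] assms by (simp add: gp_commute mult.assoc)
qed

text \<open>
  The vertex \<open>y\<close> can be shifted along the axis of \<open>x\<close> to lie close to \<open>1\<close>, if \<open>x\<close> moves it little: once
  no shift brings it closer, the path from \<open>1\<close> to it follows the axis for less than one period, and the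
  displacement of the end of that path is about twice its length.
\<close>

lemma exists_near_translate:
  assumes x: "cyc_reduced x" "x \<noteq> 1"
  shows "\<exists>k :: int. 2 * len (x powi k * y) < len (inverse y * x * y) + len x"
proof -
  obtain k :: int where k: "\<And>l. len (x powi k * y) \<le> len (x powi l * y)"
    using ex_has_least_nat[of "\<lambda>_. True" 0 "\<lambda>l. len (x powi l * y)"] by blast
  define r where "r = x powi k * y"
  have "commute x (x powi k)" "commute x (inverse (x powi k))" by (simp_all add: commute_powi)
  then have "inverse (x powi k) * x * x powi k = x"
    unfolding commute_def by (metis mult.assoc inverse_mult_self mult_1_right)
  moreover have "inverse r * x * r = inverse y * (inverse (x powi k) * x * x powi k) * y"
    by (simp add: r_def mult.assoc)
  ultimately have conj: "inverse r * x * r = inverse y * x * y" by simp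
  have "inverse r * inverse x * r = inverse (inverse y * x * y)"
    by (simp only: conj[symmetric]) (simp add: mult.assoc)
  then have conj': "len (inverse r * inverse x * r) = len (inverse y * x * y)"
    by (simp only: len_inverse)
  have "inverse x * r = x powi (k - 1) * y" "x * r = x powi (k + 1) * y"
    using powi_add[of x "-1" k] powi_add[of x 1 k] by (simp_all add: r_def add.commute mult.assoc)
  then have min: "len r \<le> len (inverse x * r)" "len r \<le> len (x * r)"
    using k by (simp_all add: r_def)
  have lx: "len x \<noteq> 0" using x by simp
  have lt: "gp x r < len x" "gp (inverse x) r < len x"
    using min len_gp[of x r] len_mult[of x r] lx by linarith+
  have "min (gp x r) (gp r (inverse x)) \<le> 0"
    using gp_ultrametric[of x r "inverse x"] x by (simp add: cyc_reduced_def)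
  then consider "gp x r = 0" | "gp (inverse x) r = 0"
    by (auto simp: min_def gp_commute[of r] split: if_splits)
  then have "2 * len r < len (inverse y * x * y) + len x"
  proof cases
    case 1
    then show ?thesis using len_conj_cyc_reduced[of "inverse x" r] lt x conj' by simp
  next
    case 2
    then show ?thesis using len_conj_cyc_reduced[of x r] lt x conj by simp
  qed
  then show ?thesis unfolding r_def by blast
qed

lemma commute_common_root:
  assumes "commute x y"
  shows "\<exists>g i j. x = g powi i \<and> y = (g :: 'a fgroup) powi j"
  using assms
proof (induction "len x" arbitrary: x y rule: less_induct)
  case less
  consider "x = 1" | "\<not> cyc_reduced x" | "cyc_reduced x" "x \<noteq> 1" by blast
  then show ?case
  proof cases
    case 1
    then have "x = y powi 0" "y = y powi 1" by simp_all
    then show ?thesis by blast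
  next
    case 2
    obtain u where "len (inverse u * x * u) + 2 * gp x (inverse x) \<le> len x"
      by (rule shorten_by_conj)
    then have "len (inverse u * x * u) < len x" using 2 by (simp add: cyc_reduced_def)
    moreover have "commute (inverse u * x * u) (inverse u * y * u)"
      using commute_conj[of "inverse u" x y] less.prems by simp
    ultimately obtain g i j where
      gij: "inverse u * x * u = g powi i" "inverse u * y * u = g powi j"
      using less.hyps by blast
    have "x = u * (inverse u * x * u) * inverse u" "y = u * (inverse u * y * u) * inverse u"
      by (simp_all add: mult.assoc)
    then have x: "x = (u * g * inverse u) powi i" and y: "y = (u * g * inverse u) powi j"
      by (simp_all only: gij conj_powi)
    show ?thesis by (intro exI conjI) (rule x, rule y)
  next
    case 3
    \<comment> \<open>Euclid's algorithm: divide \<open>y\<close> by \<open>x\<close> with a remainder shorter than \<open>x\<close>.\<close>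
    obtain k :: int where k: "2 * len (x powi k * y) < len (inverse y * x * y) + len x"
      using exists_near_translate 3 by blast
    define r where "r = x powi k * y"
    have r: "commute x r"
      unfolding r_def using less.prems by (intro commute_mult commute_powi) simp_all
    have "inverse y * x * y = x" using less.prems by (simp add: commute_def mult.assoc)
    then have "len r < len x" using k by (simp add: r_def)
    moreover have "commute r x" using r by (rule commute_sym)
    ultimately obtain g i j where g: "r = g powi i" "x = g powi j"
      using less.hyps by blast
    have "y = x powi (- k) * r" by (simp add: r_def powi_minus)
    also have "\<dots> = g powi (j * - k + i)" by (simp only: g powi_add powi_mult)
    finally have y: "y = g powi (j * - k + i)" .
    show ?thesis by (intro exI conjI) (rule g(2), rule y)
  qed
qed

lemma commute_trans:
  assumes "commute a x" "commute a y" "a \<noteq> (1 :: 'a fgroup)"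
  shows "commute x y"
proof -
  obtain g i j where g: "a = g powi i" "x = g powi j"
    using commute_common_root[OF assms(1)] by blast
  have "commute y g"
    using assms g commute_of_powi[of y g i] commute_sym by fastforce
  then show ?thesis unfolding g by (intro commute_sym[OF commute_powi])
qed

text \<open>
  An element that inverts \<open>z\<close> has a square commuting with \<open>z\<close>, hence commutes with \<open>z\<close> itself.
\<close>

lemma conj_not_inverse:
  assumes "x * z * inverse x = inverse z"
  shows "z = (1 :: 'a fgroup)"
proof (rule ccontr)
  assume z: "z \<noteq> 1"
  have "x * (x * z * inverse x) * inverse x = z"
    using assms by (metis inverse_inverse_group inverse_mult_group mult.assoc)
  then have "commute (x * x) z"
    by (simp add: commute_iff_conj mult.assoc)
  then have "commute z (x ^ 2)" by (simp add: power2_eq_square commute_sym)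
  then have "commute x z" using commute_of_power[of z x 2] commute_sym by auto
  then have "z = inverse z" using assms by (simp add: commute_iff_conj)
  then have "z ^ 2 = 1" by (metis mult_inverse_self power2_eq_square)
  then show False using z by simp
qed

text \<open>
  Both \<open>z\<close> and its conjugate are powers of one element; equal translation lengths make the exponents
  equal up to sign, and the sign is settled by \<open>conj_not_inverse\<close>.
\<close>

lemma centralizer_malnormal:
  assumes "commute c z" "commute c (x * z * inverse x)" "z \<noteq> 1" "c \<noteq> (1 :: 'a fgroup)"
  shows "commute c x"
proof -
  have "commute z (x * z * inverse x)" by (rule commute_trans[OF assms(1,2,4)])
  then obtain g i j where g: "z = g powi i" "x * z * inverse x = g powi j"
    using commute_common_root by blast
  have "nat \<bar>i\<bar> * ell g = nat \<bar>j\<bar> * ell g"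
    using arg_cong[OF g(2), of ell] by (simp only: ell_conj ell_powi g(1))
  moreover have "ell g \<noteq> 0" using g(1) assms(3) by (metis ell_eq_0 powi_eq_one_iff)
  ultimately have "nat \<bar>i\<bar> = nat \<bar>j\<bar>" by (simp only: mult_cancel2 simp_thms)
  then have "\<bar>i\<bar> = \<bar>j\<bar>" by (simp only: eq_nat_nat_iff abs_ge_zero)
  then consider "i = j" | "j = - i" by (metis abs_eq_iff)
  then show ?thesis
  proof cases
    case 1
    have "x * z * inverse x = z" unfolding g(2) unfolding g(1) 1 ..
    then have "commute z x" by (rule commute_sym[OF commute_iff_conj[THEN iffD2]])
    then show ?thesis by (rule commute_trans[OF commute_sym[OF assms(1)] _ assms(3)])
  next
    case 2
    have "x * z * inverse x = inverse z" unfolding g(2) unfolding g(1) 2 by (rule powi_minus)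
    then have "z = 1" by (rule conj_not_inverse)
    then show ?thesis using assms by simp
  qed
qed

section \<open>Overlaps of axes\<close>

text \<open>
  The case of \<open>gp_ultrametric\<close> that speaks about first letters only.
\<close>

lemma gp_eq_0_trans:
  assumes "gp x y > 0" "gp x z = 0"
  shows "gp y z = 0"
  using gp_ultrametric[of x y z] assms by (simp add: min_def split: if_splits)

lemma gp_inverse_power_cyc_reduced:
  assumes "cyc_reduced a"
  shows "gp (inverse a) (a ^ i) = 0"
  using len_mult[of a "a ^ i"] len_power_cyc_reduced[OF assms, of "Suc i"] len_power_cyc_reduced[OF assms, of i]
  by simp

lemma gp_power_inverse_power_cyc_reduced:
  assumes "cyc_reduced a"
  shows "gp (a ^ i) (inverse a ^ j) = 0"
proof -
  have "len (inverse a ^ i * inverse a ^ j) = (i + j) * len a"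
    using len_power_cyc_reduced[of "inverse a" "i + j"] assms by (simp add: power_add)
  then show ?thesis
    using len_mult[of "inverse a ^ i" "inverse a ^ j"] len_power_cyc_reduced[of "inverse a"] assms
    by (simp add: algebra_simps inverse_power_group[symmetric])
qed

lemma gp_power_Suc:
  assumes "cyc_reduced a"
  shows "gp a (a ^ Suc j) = len a"
  using gp_left[of a "a ^ j"] gp_inverse_power_cyc_reduced[OF assms, of j] by simp

text \<open>
  A vertex on the axis of \<open>a\<close> is moved by \<open>a\<close> one period ahead on the axis.
\<close>

lemma power_axis_shift:
  assumes a: "cyc_reduced a" and y: "gp y (a ^ i) = len y" "y \<noteq> 1" "len y + len a \<le> i * len a"
  shows "len (a * y) = len y + len a" "gp (a * y) (a ^ i) = len y + len a"
proof -
  have pos: "len y > 0" using y(2) by (metis len_eq_0 neq0_conv)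
  obtain k where i: "i = Suc k" using y pos by (cases i) auto
  have "gp y (inverse a) = 0"
    using gp_eq_0_trans[of "a ^ i" y "inverse a"] y(1) pos gp_inverse_power_cyc_reduced[OF a, of i]
    by (simp add: gp_commute[of "a ^ i"])
  then have "gp (inverse a) y = 0" by (simp add: gp_commute)
  then show 1: "len (a * y) = len y + len a" using len_mult[of a y] by simp
  have "inverse (a ^ i) * a ^ k = inverse a"
    by (simp only: i power_Suc2 inverse_mult_group mult.assoc inverse_mult_self mult_1_right)
  then have "gp (a ^ i) (a ^ k) = k * len a"
    using len_gp[of "a ^ i" "a ^ k"] len_power_cyc_reduced[OF a, of i] len_power_cyc_reduced[OF a, of k] i
    by (simp del: power_Suc)
  moreover have "min (gp y (a ^ i)) (gp (a ^ i) (a ^ k)) \<le> gp y (a ^ k)" by (rule gp_ultrametric)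
  ultimately have "len y \<le> gp y (a ^ k)" using y i by simp
  then have "gp y (a ^ k) = len y" by (intro le_antisym gp_le1)
  moreover have "inverse (a * y) * a ^ i = inverse y * a ^ k" by (simp add: i mult.assoc)
  ultimately show "gp (a * y) (a ^ i) = len y + len a"
    using len_gp[of y "a ^ k"] len_gp[of "a * y" "a ^ i"] 1
      len_power_cyc_reduced[OF a, of i] len_power_cyc_reduced[OF a, of k] i by (simp del: power_Suc)
qed

text \<open>
  The same for the axis of the conjugate \<open>\<beta> * a * inverse \<beta>\<close>: once the path from \<open>1\<close> to \<open>\<beta> * a ^ i\<close> has
  left the path to \<open>\<beta>\<close>, it runs along that axis.
\<close>

lemma axis_shift:
  assumes a: "cyc_reduced a"
    and x: "gp x (\<beta> * a ^ i) = len x" "gp \<beta> (\<beta> * a ^ i) < len x"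
      "len x + len a \<le> len (\<beta> * a ^ i)"
  shows "len (\<beta> * a * inverse \<beta> * x) = len x + len a"
    "gp (\<beta> * a * inverse \<beta> * x) (\<beta> * a ^ i) = len x + len a"
proof -
  define w s y where "w = \<beta> * a ^ i" and "s = gp \<beta> w" and "y = inverse \<beta> * x"
  note x' = x[folded w_def, folded s_def]
  have "min (gp \<beta> w) (gp w x) \<le> gp \<beta> x" "min (gp \<beta> x) (gp x w) \<le> gp \<beta> w"
    by (rule gp_ultrametric)+
  then have \<beta>x: "gp \<beta> x = s" using x' by (simp add: gp_commute[of w] s_def[symmetric] min_le_iff_disj)
  have ly: "len y + 2 * s = len \<beta> + len x"
    using len_gp[of \<beta> x] by (simp add: y_def \<beta>x)
  have ai: "i * len a + 2 * s = len \<beta> + len w"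
    using len_gp[of \<beta> w] len_power_cyc_reduced[OF a, of i] by (simp add: w_def s_def)
  have s: "s \<le> len \<beta>" by (simp add: s_def)
  have "inverse y * a ^ i = inverse x * w" by (simp add: y_def w_def mult.assoc)
  then have "gp y (a ^ i) = len y"
    using len_gp[of y "a ^ i"] len_gp[of x w] x' ly ai len_power_cyc_reduced[OF a, of i] by simp
  moreover have "y \<noteq> 1" using ly s x' by auto
  moreover have "len y + len a \<le> i * len a" using ly ai x' by linarith
  ultimately have ay: "len (a * y) = len y + len a" "gp (a * y) (a ^ i) = len y + len a"
    using power_axis_shift[OF a] by blast+
  have b: "s + gp (inverse \<beta>) (a ^ i) = len \<beta>"
    using gp_left[of \<beta> "a ^ i"] by (simp add: s_def w_def)
  have "min (gp (inverse \<beta>) (a * y)) (gp (a * y) (a ^ i)) \<le> gp (inverse \<beta>) (a ^ i)"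
    "min (gp (inverse \<beta>) (a ^ i)) (gp (a ^ i) (a * y)) \<le> gp (inverse \<beta>) (a * y)"
    by (rule gp_ultrametric)+
  then have "s + gp (inverse \<beta>) (a * y) = len \<beta>"
    using b ay ly x' by (simp add: gp_commute[of "a ^ i"] min_le_iff_disj)
  then have lx: "len (\<beta> * (a * y)) = len x + len a"
    using len_mult[of \<beta> "a * y"] ay ly by linarith
  moreover have A: "\<beta> * a * inverse \<beta> * x = \<beta> * (a * y)" by (simp add: y_def mult.assoc)
  ultimately show "len (\<beta> * a * inverse \<beta> * x) = len x + len a" by simp
  have "inverse (\<beta> * (a * y)) * w = inverse (a * y) * a ^ i" by (simp add: w_def mult.assoc)
  then have "gp (\<beta> * (a * y)) w = len x + len a"
    using len_gp[of "\<beta> * (a * y)" w] len_gp[of "a * y" "a ^ i"] lx ay ly ai len_power_cyc_reduced[OF a, of i]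
    by simp
  then show "gp (\<beta> * a * inverse \<beta> * x) (\<beta> * a ^ i) = len x + len a" by (simp add: A w_def)
qed

lemma gp_prefix:
  assumes "gp x w = len x" "len x \<le> gp w v"
  shows "gp x v = len x"
  using gp_ultrametric[of x w v] assms gp_le1[of x v] by simp

text \<open>
  The theorem of Fine and Wilf in geometric form. Let two axes share a segment of length more than the
  sum of the two periods. Both composites of the two translations move the beginning of the segment
  by the sum of the periods along it, so they agree at one vertex, and the action on the tree is free.
\<close>

lemma overlap_commute:
  assumes a: "cyc_reduced a" and b: "cyc_reduced b"
    and le: "gp \<beta> (\<beta> * a ^ i) + len a + len b < gp (\<beta> * a ^ i) (b ^ j)"
  shows "commute (\<beta> * a * inverse \<beta>) b"
proof -
  define w v A where "w = \<beta> * a ^ i" and "v = b ^ j" and "A = \<beta> * a * inverse \<beta>"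
  define t where "t = Suc (gp \<beta> w)"
  have m: "t + len a + len b \<le> gp w v" using le by (simp add: w_def v_def t_def)
  have mw: "gp w v \<le> len w" and mv: "gp w v \<le> len v" by simp_all
  have lv: "len v = j * len b" using len_power_cyc_reduced[OF b] by (simp add: v_def)
  obtain x where x: "len x = t" "gp x w = t" using exists_prefix[of t w] m mw by auto
  have shA: "len (A * z) = len z + len a \<and> gp (A * z) v = len z + len a"
    if "gp z v = len z" "t \<le> len z" "len z + len a \<le> gp w v" for z
  proof -
    have "gp z w = len z" using gp_prefix[of z v w] that by (simp add: gp_commute[of v])
    moreover have "len z + len a \<le> len w" using that(3) mw by linarith
    moreover have "gp \<beta> w < len z" using that(2) by (simp add: t_def)
    ultimately have "len (A * z) = len z + len a" "gp (A * z) w = len z + len a"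
      using axis_shift[OF a, of z \<beta> i] by (simp_all add: w_def A_def)
    then show ?thesis using gp_prefix[of "A * z" w v] that by simp
  qed
  have shb: "len (b * z) = len z + len b \<and> gp (b * z) v = len z + len b"
    if "gp z v = len z" "t \<le> len z" "len z + len b \<le> gp w v" for z
  proof -
    have "z \<noteq> 1" using that by (auto simp: t_def)
    then show ?thesis using power_axis_shift[OF b, of z j] that mv lv by (simp add: v_def)
  qed
  have xv: "gp x v = len x" using gp_prefix[of x w v] x m by simp
  have 1: "len (A * x) = t + len a" "gp (A * x) v = t + len a"
    using shA[of x] xv x m by simp_all
  have 2: "len (b * x) = t + len b" "gp (b * x) v = t + len b"
    using shb[of x] xv x m by simp_all
  have 3: "len (b * (A * x)) = t + len a + len b" "gp (b * (A * x)) v = t + len a + len b"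
    using shb[of "A * x"] 1 m by simp_all
  have 4: "len (A * (b * x)) = t + len a + len b" "gp (A * (b * x)) v = t + len a + len b"
    using shA[of "b * x"] 2 m by simp_all
  have "min (gp (A * (b * x)) v) (gp v (b * (A * x))) \<le> gp (A * (b * x)) (b * (A * x))"
    by (rule gp_ultrametric)
  then have "A * (b * x) = b * (A * x)"
    using 3 4 by (intro eq_of_gp) (simp_all add: gp_commute[of v])
  then have "A * b * x = b * A * x" by (simp add: mult.assoc)
  then show ?thesis by (simp add: commute_def A_def)
qed

text \<open>
  After at most \<open>len \<beta>\<close> steps the first path runs along the translate by \<open>\<beta>\<close> of the axis of \<open>a\<close>. If it shared
  more than two periods with the axis of \<open>a\<close> itself, then \<open>a\<close> would commute with a conjugate of itself, and
  then with the conjugating element.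
\<close>

lemma axis_overlap_le:
  assumes a: "cyc_reduced a" "a \<noteq> 1" and n: "\<not> commute a \<beta>" and c: "c = a \<or> c = inverse a"
    and e: "e = a \<or> e = inverse a"
  shows "gp (\<beta> * e ^ i) (c ^ j) \<le> len \<beta> + 2 * len a"
proof (rule ccontr)
  assume "\<not> ?thesis"
  moreover have "len e = len a" "len c = len a" "cyc_reduced e" "cyc_reduced c" using c e a by auto
  ultimately have "commute (\<beta> * e * inverse \<beta>) c"
    using gp_le1[of \<beta> "\<beta> * e ^ i"] by (intro overlap_commute[of _ _ _ i j]) linarith+
  then have "commute c (\<beta> * e * inverse \<beta>)" by (rule commute_sym)
  then have "commute a (\<beta> * e * inverse \<beta>)" using c by auto
  moreover have "commute a e" "e \<noteq> 1" using e a by auto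
  ultimately have "commute a \<beta>" using centralizer_malnormal a by blast
  then show False using n by simp
qed

lemma powi_as_power: "\<exists>e n. (e = a \<or> e = inverse a) \<and> a powi i = e ^ n"
  by (auto simp: power_int_def)

lemma transversal:
  assumes "cyc_reduced a" "a \<noteq> 1" "\<not> commute a \<beta>"
  shows "gp (\<beta> * a powi i) (a powi j) \<le> len \<beta> + 2 * len a"
proof -
  obtain e n where e: "e = a \<or> e = inverse a" "a powi i = e ^ n" using powi_as_power by blast
  obtain c m where c: "c = a \<or> c = inverse a" "a powi j = c ^ m" using powi_as_power by blast
  show ?thesis unfolding e(2) c(2) by (rule axis_overlap_le[OF assms c(1) e(1)])
qed

section \<open>Translation length of a product of powers\<close>

text \<open>
  Cyclic rotation keeps a cyclically reduced word cyclically reduced.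
\<close>

lemma conj_rotation:
  assumes "cyc_reduced b" "c = b \<or> c = inverse b" "gp u c = len u"
  shows "cyc_reduced (inverse u * b * u)"
proof -
  have "len (inverse u * c * u) \<le> len (inverse u * c) + len u" by (rule len_mult_le)
  also have "\<dots> = len c" using len_gp[of u c] gp_le2[of u c] assms(3) by linarith
  finally have "len (inverse u * c * u) \<le> len b" using assms(2) by auto
  moreover have "inverse u * c * u = inverse u * b * u
      \<or> inverse u * c * u = inverse (inverse u * b * u)"
    using assms(2) by (auto simp: mult.assoc)
  then have "len (inverse u * c * u) = len (inverse u * b * u)" using len_inverse by metis
  moreover have "ell (inverse u * b * u) = len b" using assms(1) by (simp add: cyc_reduced_iff_ell)
  ultimately show ?thesis
    unfolding cyc_reduced_iff_ell using ell_le[of "inverse u * b * u"] by linarith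
qed

text \<open>
  Put the axis of \<open>a\<close> through \<open>1\<close>. The vertex \<open>1\<close> can be moved along this axis and the axis of \<open>b\<close> be
  reached by a path \<open>s\<close> such that \<open>s\<close> follows the axis of \<open>a\<close> for less than a period and meets the axis of
  \<open>b\<close> in its end only. A shortest path \<open>s\<close> over all choices has these properties.
\<close>

lemma exists_short_connection:
  assumes a: "cyc_reduced a" "a \<noteq> 1"
  obtains n :: int and s b0 where
    "inverse (a powi n) * b * a powi n = s * b0 * inverse s" "cyc_reduced b0"
    "gp s a < len a" "gp s (inverse a) < len a"
    "gp (inverse s) b0 = 0" "gp (inverse s) (inverse b0) = 0"
proof -
  define P where "P = (\<lambda>(n :: int, s, b0).
    inverse (a powi n) * b * a powi n = s * b0 * inverse s \<and> cyc_reduced b0)"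
  obtain x where "cyc_reduced (x * b * inverse x)" using exists_cyc_reduced_conj by blast
  then have "P (0, inverse x, x * b * inverse x)" by (simp add: P_def mult.assoc)
  then obtain t where t: "P t" "\<And>t'. P t' \<Longrightarrow> len (fst (snd t)) \<le> len (fst (snd t'))"
    using ex_has_least_nat[of P _ "\<lambda>t. len (fst (snd t))"] by blast
  obtain n s b0 where "t = (n, s, b0)" by (cases t)
  then have P: "P (n, s, b0)"
    and least: "P (n', s', b0') \<Longrightarrow> len s \<le> len s'" for n' s' b0'
    using t(1) t(2)[of "(n', s', b0')"] by simp_all
  then have eq: "inverse (a powi n) * b * a powi n = s * b0 * inverse s" and b0: "cyc_reduced b0"
    by (simp_all add: P_def)
  have 1: "gp s c < len a" if c: "c = a powi k" "len c = len a" for c k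
  proof (rule ccontr)
    assume "\<not> ?thesis"
    then have "gp s c = len a" using c gp_le2[of s c] by simp
    then have "len (inverse c * s) + len a = len s"
      using len_gp[of c s] c by (simp add: gp_commute)
    moreover have "inverse (a powi (n + k)) * b * a powi (n + k)
        = inverse c * (inverse (a powi n) * b * a powi n) * c"
      by (simp add: powi_add c mult.assoc)
    then have "inverse (a powi (n + k)) * b * a powi (n + k) = inverse c * (s * b0 * inverse s) * c"
      by (simp only: eq)
    then have "P (n + k, inverse c * s, b0)" using b0 by (simp add: P_def mult.assoc)
    moreover have "len a \<noteq> 0" using a by simp
    ultimately show False using least by fastforce
  qed
  have 2: "gp (inverse s) c = 0" if c: "c = b0 \<or> c = inverse b0" for c
  proof (rule ccontr)
    assume pos: "\<not> ?thesis"
    define k where "k = gp (inverse s) c"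
    obtain u where u: "len u = k" "gp u c = k"
      using exists_prefix[of k c] by (auto simp: k_def)
    have "gp u (inverse s) = k"
      using gp_prefix[of u c "inverse s"] u by (simp add: k_def gp_commute[of c])
    then have "len (s * u) + k = len s"
      using len_mult[of s u] u by (simp add: gp_commute)
    have "cyc_reduced (inverse u * b0 * u)" by (rule conj_rotation[OF b0 c]) (simp add: u)
    moreover have "s * b0 * inverse s = s * u * (inverse u * b0 * u) * inverse (s * u)"
      by (simp add: mult.assoc)
    ultimately have "P (n, s * u, inverse u * b0 * u)" by (simp only: P_def prod.case eq simp_thms)
    then have "len s \<le> len (s * u)" by (rule least)
    then show False using \<open>len (s * u) + k = len s\<close> pos by (simp add: k_def)
  qed
  show thesis
    using that[OF eq b0] 1[of a 1] 1[of "inverse a" "-1"] 2 by simp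
qed

text \<open>
  For an element \<open>b\<close> of smaller translation length the path to \<open>b ^ q\<close> follows the axis of \<open>a\<close> for at most
  three periods, however large \<open>q\<close> is: less than one along \<open>s\<close>, and two along the axis of \<open>b\<close> by
  \<open>overlap_commute\<close>. The alternative is that the path to \<open>b ^ q\<close> is itself short.
\<close>

lemma overlap_conj_power:
  assumes a: "cyc_reduced a" "a \<noteq> 1" and b0: "cyc_reduced b0" "b0 \<noteq> 1" "len b0 \<le> len a"
    and s: "gp s a < len a" "gp s (inverse a) < len a"
      "gp (inverse s) b0 = 0" "gp (inverse s) (inverse b0) = 0"
    and n: "\<not> commute a (s * b0 * inverse s)" and q: "q > 0" and c: "c = a \<or> c = inverse a"
  shows "gp ((s * b0 * inverse s) ^ q) (c ^ j) \<le> 3 * len a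
    \<or> len ((s * b0 * inverse s) ^ q) \<le> 6 * len a"
proof -
  define v where "v = s * b0 ^ q"
  have L: "len a > 0" "len b0 > 0" using a b0 by (metis len_eq_0 neq0_conv)+
  have first: "gp (inverse s) (d ^ q) = 0" if d: "gp (inverse s) d = 0" "cyc_reduced d" "len d > 0" for d
  proof -
    have "min (gp (inverse s) (d ^ q)) (gp (d ^ q) d) \<le> gp (inverse s) d" by (rule gp_ultrametric)
    moreover have "gp d (d ^ q) = len d" using gp_power_Suc[of d "q - 1"] d q by simp
    ultimately show ?thesis using d by (simp add: gp_commute[of "d ^ q"] min_le_iff_disj)
  qed
  have s0: "gp (inverse s) (b0 ^ q) = 0" "gp (inverse s) (inverse b0 ^ q) = 0"
    using first[of b0] first[of "inverse b0"] b0 s L by simp_all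
  have sv: "gp s v = len s" and lv: "len v = len s + q * len b0"
    using gp_left[of s "b0 ^ q"] len_mult[of s "b0 ^ q"] s0 len_power_cyc_reduced[OF b0(1), of q]
    by (simp_all add: v_def)
  have cc: "cyc_reduced c" "len c = len a" using c a by auto
  have vc: "gp v (c ^ j) \<le> 3 * len a"
  proof (cases "j = 0")
    case False
    have "\<not> commute (s * b0 * inverse s) c" using n c commute_sym by auto
    then have 1: "gp v (c ^ j) \<le> len s + len b0 + len a"
      using overlap_commute[OF b0(1) cc(1), of s q j] sv cc by (simp add: v_def not_less) (use not_less in blast)
    have "min (gp s (c ^ j)) (gp (c ^ j) c) \<le> gp s c" by (rule gp_ultrametric)
    moreover have "gp (c ^ j) c = len a"
      using gp_power_Suc[OF cc(1), of "j - 1"] False cc by (simp add: gp_commute[of "c ^ j"])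
    moreover have "gp s c < len a" using c s by auto
    ultimately have "gp s (c ^ j) < len a" by linarith
    moreover have "min (gp s v) (gp v (c ^ j)) \<le> gp s (c ^ j)" by (rule gp_ultrametric)
    ultimately show ?thesis using 1 sv b0 by linarith
  qed simp
  have "gp (inverse v) (inverse s) = 0"
  proof -
    have "inverse v = inverse b0 ^ q * inverse s" by (simp add: v_def inverse_power_group)
    then have "gp (inverse b0 ^ q) (inverse v) = q * len b0"
      using gp_left[of "inverse b0 ^ q" "inverse s"] s0(1) len_power_cyc_reduced[of "inverse b0" q] b0
      by (simp add: gp_commute inverse_power_group[symmetric])
    then show ?thesis
      using gp_eq_0_trans[of "inverse b0 ^ q" "inverse v" "inverse s"] s0(2) q L
      by (simp add: gp_commute)
  qed
  moreover have bq: "(s * b0 * inverse s) ^ q = v * inverse s" by (simp add: conj_power v_def)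
  ultimately have "gp v ((s * b0 * inverse s) ^ q) = len v"
    and l: "len ((s * b0 * inverse s) ^ q) = len v + len s"
    using gp_left[of v "inverse s"] len_mult[of v "inverse s"] by simp_all
  moreover have "min (gp v ((s * b0 * inverse s) ^ q)) (gp ((s * b0 * inverse s) ^ q) (c ^ j))
      \<le> gp v (c ^ j)" by (rule gp_ultrametric)
  ultimately show ?thesis using vc lv by linarith
qed

text \<open>
  The long powers of \<open>a\<close> on the two sides of \<open>b ^ q\<close> lose at most ten periods each to cancellation, so
  part of them survives. That ten periods suffice is \<open>axis_overlap_le\<close> if \<open>b ^ q\<close> is short and
  \<open>overlap_conj_power\<close> if it is long.
\<close>

lemma ell_le_product_of_powers:
  assumes n: "\<not> commute a b" and le: "ell b \<le> ell a" and p: "p \<ge> 30" and q: "q > 0"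
  shows "ell a \<le> ell (a ^ p * b ^ q)"
proof -
  obtain x where x: "cyc_reduced (x * a * inverse x)" using exists_cyc_reduced_conj by blast
  define a1 where "a1 = x * a * inverse x"
  have a1: "cyc_reduced a1" "a1 \<noteq> 1"
    using x n by (auto simp: a1_def) (metis commute_one(1) mult_1_right commute_conj mult_inverse_self)
  obtain k :: int and s b0 where kb:
    "inverse (a1 powi k) * (x * b * inverse x) * a1 powi k = s * b0 * inverse s" "cyc_reduced b0"
    "gp s a1 < len a1" "gp s (inverse a1) < len a1"
    "gp (inverse s) b0 = 0" "gp (inverse s) (inverse b0) = 0"
    using exists_short_connection[OF a1, of "x * b * inverse x"] by blast
  define y where "y = inverse (a1 powi k) * x"
  define b1 where "b1 = s * b0 * inverse s"
  have b1: "b1 = y * b * inverse y"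
    by (simp only: b1_def y_def kb(1)[symmetric]) (simp add: mult.assoc)
  have "commute a1 (inverse (a1 powi k))" by (simp add: commute_powi)
  then have a1y: "a1 = y * a * inverse y"
    by (simp add: y_def a1_def[symmetric] mult.assoc) (simp add: a1_def mult.assoc commute_def)
  have n1: "\<not> commute a1 b1" using n by (simp add: a1y b1)
  then have n1': "\<not> commute a1 (b1 ^ q)" using commute_of_power q by blast
  have "b0 \<noteq> 1" using n1 by (auto simp: b1_def)
  have "ell b1 = ell b0" by (simp only: b1_def ell_conj)
  moreover have "ell b1 = ell b" by (simp only: b1 ell_conj)
  ultimately have "ell b0 = ell b" by simp
  then have lb0: "len b0 \<le> len a1"
    using le kb(2) a1(1) by (simp add: cyc_reduced_iff_ell) (simp add: a1_def)
  define L where "L = len a1"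
  have L: "L > 0" using a1 by (metis L_def len_eq_0 neq0_conv)
  have far: "gp ((s * d * inverse s) ^ q * e ^ i) (c ^ j) \<le> 10 * L"
    if d: "d = b0 \<or> d = inverse b0" and e: "e = a1 \<or> e = inverse a1" and c: "c = a1 \<or> c = inverse a1"
    for d e c i j
  proof -
    define B where "B = (s * d * inverse s) ^ q"
    have sinv: "s * inverse b0 * inverse s = inverse b1" by (simp add: b1_def mult.assoc)
    have B: "B = b1 ^ q \<or> B = inverse (b1 ^ q)"
      using d by (auto simp: B_def sinv inverse_power_group) (simp add: b1_def)
    have ov: "gp ((s * d' * inverse s) ^ q) (c' ^ j') \<le> 3 * L \<or> len ((s * d' * inverse s) ^ q) \<le> 6 * L"
      if "d' = b0 \<or> d' = inverse b0" "c' = a1 \<or> c' = inverse a1" for d' c' j'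
    proof -
      have "cyc_reduced d'" "d' \<noteq> 1" "len d' \<le> len a1"
        "gp (inverse s) d' = 0" "gp (inverse s) (inverse d') = 0"
        using that(1) kb(2,5,6) lb0 \<open>b0 \<noteq> 1\<close> by auto
      moreover have "\<not> commute a1 (s * d' * inverse s)"
        using that(1)
      proof
        assume "d' = b0"
        then show ?thesis using n1 by (simp only: b1_def not_False_eq_True)
      next
        assume "d' = inverse b0"
        then show ?thesis using n1 by (simp only: sinv commute_inverse_iff not_False_eq_True)
      qed
      ultimately show ?thesis
        unfolding L_def using overlap_conj_power[OF a1 _ _ _ kb(3,4) _ _ _ q that(2)] by blast
    qed
    show ?thesis
    proof (cases "len B \<le> 8 * L")
      case True
      have "\<not> commute a1 B" using n1' B by auto
      then have "gp (B * e ^ i) (c ^ j) \<le> len B + 2 * len a1"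
        by (rule axis_overlap_le[OF a1 _ c e])
      then show ?thesis using True by (simp add: B_def L_def)
    next
      case False
      have Bi: "inverse B = (s * inverse d * inverse s) ^ q"
        by (simp add: B_def inverse_power_group mult.assoc)
      have id: "inverse d = b0 \<or> inverse d = inverse b0" using d by auto
      have 1: "gp B (c ^ j) \<le> 3 * L" using ov[OF d c, of j] False by (simp add: B_def)
      have "len (inverse B) > 8 * L" using False by simp
      then have 2: "gp (inverse B) (e ^ i) \<le> 3 * L"
        using ov[OF id e, of i] unfolding Bi by linarith
      have "5 * L < gp B (B * e ^ i)" using gp_left[of B "e ^ i"] 2 False by linarith
      moreover have "min (gp B (B * e ^ i)) (gp (B * e ^ i) (c ^ j)) \<le> gp B (c ^ j)"
        by (rule gp_ultrametric)
      ultimately have "gp (B * e ^ i) (c ^ j) \<le> 3 * L" using 1 by linarith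
      then show ?thesis by (simp add: B_def)
    qed
  qed
  \<comment> \<open>Conjugating \<open>a1 ^ p * b1 ^ q\<close> puts \<open>b1 ^ q\<close> between two powers of \<open>a1\<close> with exponents at
    least 15, of which at least five periods survive at both ends; so the conjugate is cyclically reduced.\<close>
  define r where "r = p - 15"
  have pr: "p = r + 15" "r \<ge> 15" using p by (simp_all add: r_def)
  define w where "w = a1 ^ 15 * (b1 ^ q * a1 ^ r)"
  have w1: "5 * L \<le> gp (a1 ^ 15) w"
    using gp_left[of "a1 ^ 15" "b1 ^ q * a1 ^ r"] far[of b0 a1 "inverse a1" r 15]
      len_power_cyc_reduced[OF a1(1), of 15]
    by (simp add: w_def b1_def[symmetric] inverse_power_group gp_commute L_def)
  have wi: "inverse w = inverse a1 ^ r * (inverse b1 ^ q * inverse a1 ^ 15)"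
    by (simp add: w_def inverse_power_group mult.assoc)
  have "gp (inverse b1 ^ q * inverse a1 ^ 15) (a1 ^ r) \<le> 10 * L"
    using far[of "inverse b0" "inverse a1" a1 15 r] by (simp add: b1_def mult.assoc)
  moreover have "len (inverse a1 ^ r) = r * L" using len_power_cyc_reduced[of "inverse a1" r] a1 by (simp add: L_def)
  moreover have "15 * L \<le> r * L" using pr by simp
  moreover have "gp (inverse a1 ^ r) (inverse w) + gp (a1 ^ r) (inverse b1 ^ q * inverse a1 ^ 15)
      = len (inverse a1 ^ r)"
    using gp_left[of "inverse a1 ^ r" "inverse b1 ^ q * inverse a1 ^ 15"]
    by (simp add: wi inverse_power_group[of "inverse a1" r])
  ultimately have w2: "5 * L \<le> gp (inverse a1 ^ r) (inverse w)"
    using gp_commute[of "a1 ^ r" "inverse b1 ^ q * inverse a1 ^ 15"] by linarith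
  have "gp w (inverse a1 ^ r) = 0"
    using gp_eq_0_trans[of "a1 ^ 15" w] w1 L gp_power_inverse_power_cyc_reduced[OF a1(1), of 15 r] by simp
  then have "gp (inverse w) w = 0"
    using gp_eq_0_trans[of "inverse a1 ^ r" "inverse w" w] w2 L by (simp add: gp_commute)
  then have "cyc_reduced w" by (simp add: cyc_reduced_def gp_commute)
  then have "5 * L \<le> ell w" using w1 gp_le2[of "a1 ^ 15" w] by (simp add: cyc_reduced_iff_ell)
  moreover have "ell w = ell (a1 ^ p * b1 ^ q)"
    using ell_mult_commute[of "a1 ^ 15 * b1 ^ q" "a1 ^ r"] by (simp add: w_def pr power_add mult.assoc)
  moreover have "ell (a1 ^ p * b1 ^ q) = ell (a ^ p * b ^ q)"
  proof -
    have "a1 ^ p * b1 ^ q = y * (a ^ p * b ^ q) * inverse y"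
      by (simp only: a1y b1 conj_power) (simp add: mult.assoc)
    then show ?thesis by (simp only: ell_conj)
  qed
  moreover have "L = ell a" using a1(1) by (simp add: L_def cyc_reduced_iff_ell) (simp add: a1_def)
  ultimately show ?thesis by linarith
qed

lemma max_ell_le_product_of_powers:
  assumes n: "\<not> commute a b" and "p \<ge> 30" "q \<ge> 30"
  shows "ell a \<le> ell (a ^ p * b ^ q) \<and> ell b \<le> ell (a ^ p * b ^ q)"
proof (cases "ell b \<le> ell a")
  case True
  then show ?thesis using ell_le_product_of_powers[OF n True, of p q] assms by simp
next
  case False
  have "\<not> commute b a" using n commute_sym by blast
  then have "ell b \<le> ell (b ^ q * a ^ p)"
    using ell_le_product_of_powers[of b a q p] False assms by simp
  then show ?thesis using False ell_mult_commute[of "a ^ p" "b ^ q"] by simp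
qed

section \<open>Words and their values\<close>

definition winv :: "'i letter list \<Rightarrow> 'i letter list" where
  "winv w = rev (map inv_letter w)"

definition wpow :: "'i letter list \<Rightarrow> nat \<Rightarrow> 'i letter list" where
  "wpow w n = concat (replicate n w)"

text \<open>
  Words are evaluated without reducing them, so that concatenation of words is multiplication of values.
\<close>

definition ev :: "('i \<Rightarrow> 'a :: mult_group) \<Rightarrow> 'i letter list \<Rightarrow> 'a" where
  "ev A w = foldr (\<lambda>a y. (if snd a then A (fst a) else inverse (A (fst a))) * y) w 1"

lemma ev_Nil [simp]: "ev A [] = 1"
  by (simp add: ev_def)

lemma ev_Cons [simp]: "ev A (a # w) = (if snd a then A (fst a) else inverse (A (fst a))) * ev A w"
  by (simp add: ev_def)

lemma ev_append [simp]: "ev A (u @ v) = ev A u * ev A v"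
  by (induction u) (simp_all add: mult.assoc)

lemma ev_winv [simp]: "ev A (winv w) = inverse (ev A w)"
  by (induction w) (simp_all add: winv_def inv_letter_def)

lemma ev_wpow [simp]: "ev A (wpow w n) = ev A w ^ n"
  by (induction n) (simp_all add: wpow_def)

lemma ev_conj: "ev (\<lambda>i. x * A i * inverse x) w = x * ev A w * inverse x"
  by (induction w) (simp_all add: mult.assoc)

lemma len_ev_le:
  assumes "\<And>a. a \<in> set w \<Longrightarrow> len (A (fst a)) \<le> M"
  shows "len (ev A w) \<le> length w * M"
  using assms
proof (induction w)
  case (Cons a w)
  then have "len (ev A w) \<le> length w * M" "len (A (fst a)) \<le> M" by simp_all
  then show ?case
    using len_mult_le[of "if snd a then A (fst a) else inverse (A (fst a))" "ev A w"] by auto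
qed simp

lemma winv_append [simp]: "winv (u @ v) = winv v @ winv u"
  by (simp add: winv_def)

lemma winv_winv [simp]: "winv (winv w) = w"
  by (induction w) (simp_all add: winv_def)

lemma set_winv_subset: "set w \<subseteq> X \<times> UNIV \<Longrightarrow> set (winv w) \<subseteq> X \<times> UNIV"
  by (auto simp: winv_def inv_letter_def)

lemma set_wpow_subset: "set w \<subseteq> X \<times> UNIV \<Longrightarrow> set (wpow w n) \<subseteq> X \<times> UNIV"
  by (auto simp: wpow_def)

section \<open>Counting quasimorphisms\<close>

text \<open>
  \<open>occ p n w\<close> holds if \<open>w\<close> contains \<open>n\<close> pairwise disjoint occurrences of \<open>p\<close>. Disjointness is what makes
  the counting functions additive up to an error that does not depend on \<open>p\<close>.
\<close>

inductive occ :: "'b list \<Rightarrow> nat \<Rightarrow> 'b list \<Rightarrow> bool" for p where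
  occ_0: "occ p 0 w"
| occ_Suc: "occ p n v \<Longrightarrow> occ p (Suc n) (u @ p @ v)"

lemma occ_append_left: "occ p n w \<Longrightarrow> occ p n (u @ w)"
proof (induction rule: occ.induct)
  case (occ_Suc n v u')
  then show ?case using occ.occ_Suc[of p n v "u @ u'"] by simp
qed (rule occ.occ_0)

lemma occ_append: "occ p n u \<Longrightarrow> occ p m v \<Longrightarrow> occ p (n + m) (u @ v)"
proof (induction rule: occ.induct)
  case (occ_0 w)
  then show ?case by (simp add: occ_append_left)
next
  case (occ_Suc n w u)
  then show ?case using occ.occ_Suc[of p "n + m" "w @ v" u] by simp
qed

lemma occ_le_length: "occ p n w \<Longrightarrow> p \<noteq> [] \<Longrightarrow> n \<le> length w"
proof (induction rule: occ.induct)
  case (occ_Suc n v u)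
  then have "length p > 0" "n \<le> length v" by simp_all
  then show ?case by (simp only: length_append)
qed simp

lemma occ_imp_factor: "occ p n w \<Longrightarrow> n \<noteq> 0 \<Longrightarrow> \<exists>u v. w = u @ p @ v"
  by (induction rule: occ.induct) auto

text \<open>
  At most one of several disjoint occurrences straddles the boundary.
\<close>

lemma occ_split:
  assumes "occ p n (u @ v)"
  shows "\<exists>i j. occ p i u \<and> occ p j v \<and> n \<le> i + j + 1"
  using assms
proof (induction n "u @ v" arbitrary: u rule: occ.induct)
  case occ_0
  have "occ p 0 u" "occ p 0 v" by (rule occ.occ_0)+
  then show ?case by force
next
  case (occ_Suc n y x)
  have "\<exists>r. (x = u @ r \<and> r @ p @ y = v) \<or> (x @ r = u \<and> p @ y = r @ v)"
    using occ_Suc.hyps(3) by (auto simp: append_eq_append_conv2)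
  then consider (right) r where "x = u @ r" "v = r @ p @ y"
    | (left) r where "u = x @ r" "p @ y = r @ v" by blast
  then show ?case
  proof cases
    case right
    have "occ p 0 u" by (rule occ.occ_0)
    moreover have "occ p (Suc n) v" unfolding right(2) by (rule occ.occ_Suc[OF occ_Suc.hyps(1)])
    ultimately show ?thesis by force
  next
    case left
    from left(2) obtain r' where "(p = r @ r' \<and> r' @ y = v) \<or> (p @ r' = r \<and> y = r' @ v)"
      by (auto simp: append_eq_append_conv2)
    then show ?thesis
    proof
      assume "p = r @ r' \<and> r' @ y = v"
      then have "occ p n v" using occ_append_left[OF occ_Suc.hyps(1)] by blast
      moreover have "occ p 0 u" by (rule occ.occ_0)
      ultimately show ?thesis by force
    next
      assume r': "p @ r' = r \<and> y = r' @ v"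
      then obtain i j where ij: "occ p i r'" "occ p j v" "n \<le> i + j + 1"
        using occ_Suc.hyps(2) by blast
      have "occ p (Suc i) u" using occ.occ_Suc[OF ij(1), of x] left(1) r' by simp
      then show ?thesis using ij by force
    qed
  qed
qed

definition cnt :: "'b list \<Rightarrow> 'b list \<Rightarrow> nat" where
  "cnt p w = (GREATEST n. occ p n w)"

lemma occ_cnt: "p \<noteq> [] \<Longrightarrow> occ p (cnt p w) w"
  unfolding cnt_def by (rule GreatestI_nat[of _ 0 "length w"]) (auto intro: occ_0 occ_le_length)

lemma occ_le_cnt: "p \<noteq> [] \<Longrightarrow> occ p n w \<Longrightarrow> n \<le> cnt p w"
  unfolding cnt_def by (rule Greatest_le_nat[of _ _ "length w"]) (auto intro: occ_le_length)

lemma cnt_append: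
  assumes "p \<noteq> []"
  shows "cnt p u + cnt p v \<le> cnt p (u @ v)" "cnt p (u @ v) \<le> cnt p u + cnt p v + 1"
proof -
  show "cnt p u + cnt p v \<le> cnt p (u @ v)"
    by (intro occ_le_cnt occ_append occ_cnt assms)
  obtain i j where "occ p i u" "occ p j v" "cnt p (u @ v) \<le> i + j + 1"
    using occ_split occ_cnt[OF assms] by blast
  then show "cnt p (u @ v) \<le> cnt p u + cnt p v + 1"
    using occ_le_cnt[OF assms, of i u] occ_le_cnt[OF assms, of j v] by linarith
qed

text \<open>
  The bound 3 is the defect of the counting quasimorphisms below; what matters is that one bound serves
  all of them.
\<close>

definition quasimorphism :: "('a :: mult_group \<Rightarrow> int) \<Rightarrow> bool" where
  "quasimorphism h \<longleftrightarrow> (\<forall>x. h (inverse x) = - h x) \<and> (\<forall>x y. \<bar>h (x * y) - h x - h y\<bar> \<le> 3)"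

text \<open>
  The counting quasimorphism of Brooks: occurrences of \<open>p\<close> minus occurrences of its inverse, the latter
  being counted as occurrences of \<open>p\<close> in the inverse word.
\<close>

definition brooks :: "'a letter list \<Rightarrow> 'a fgroup \<Rightarrow> int" where
  "brooks p x = int (cnt p (word x)) - int (cnt p (winv (word x)))"

lemma word_inverse: "word (inverse x) = winv (word x)"
  by (simp add: inverse_fgroup.rep_eq winv_def)

lemma word_mult_decomp:
  obtains a b c where "word x = a @ c" "word y = winv c @ b" "word (x * y) = a @ b"
proof
  define u where "u = winv (word x)"
  have x: "word x = winv u" by (simp add: u_def)
  have "reduced u" by (simp add: u_def winv_def reduced_rev_inv_letter)
  then have "word (x * y)
      = winv (drop (lcp u (word y)) u) @ drop (lcp u (word y)) (word y)"
    using reduce_inverse_append[of u "word y"] by (simp add: times_fgroup.rep_eq x winv_def)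
  then show "word (x * y) = winv (drop (lcp u (word y)) u) @ drop (lcp u (word y)) (word y)" .
  show "word x = winv (drop (lcp u (word y)) u) @ winv (take (lcp u (word y)) u)"
    by (simp only: x winv_append[symmetric] append_take_drop_id)
  show "word y = winv (winv (take (lcp u (word y)) u)) @ drop (lcp u (word y)) (word y)"
    by (simp only: winv_winv take_lcp_eq[of u "word y"] append_take_drop_id)
qed

lemma quasimorphism_brooks:
  assumes "p \<noteq> []"
  shows "quasimorphism (brooks p)"
  unfolding quasimorphism_def
proof (intro conjI allI)
  fix x y
  show "brooks p (inverse x) = - brooks p x"
    by (simp add: brooks_def word_inverse)
  obtain a b c where abc: "word x = a @ c" "word y = winv c @ b" "word (x * y) = a @ b"
    by (rule word_mult_decomp)
  note app = cnt_append[OF assms]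
  show "\<bar>brooks p (x * y) - brooks p x - brooks p y\<bar> \<le> 3"
    using app[of a c] app[of "winv c" "winv a"] app[of "winv c" b] app[of "winv b" c]
      app[of a b] app[of "winv b" "winv a"]
    by (simp add: brooks_def abc)
qed

lemma word_mult_reduced:
  assumes "gp (inverse x) y = 0"
  shows "word (x * y) = word x @ word y"
proof -
  have "reduced (winv (word x))" by (simp add: winv_def reduced_rev_inv_letter)
  moreover have "lcp (winv (word x)) (word y) = 0"
    using assms by (simp add: gp_def word_inverse)
  ultimately show ?thesis
    using reduce_inverse_append[of "winv (word x)" "word y"]
    by (simp add: times_fgroup.rep_eq winv_def[symmetric])
qed

lemma word_power_cyc_reduced:
  assumes "cyc_reduced g"
  shows "word (g ^ Suc n) = word g @ word (g ^ n)"
  using word_mult_reduced[of g "g ^ n"] gp_inverse_power_cyc_reduced[OF assms, of n] by simp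

text \<open>
  An occurrence of \<open>g\<close> along the axis of \<open>g\<close> in the backward direction would provide a vertex at which
  the translations by \<open>inverse g\<close> and by a conjugate of \<open>g\<close> agree, so \<open>g\<close> would be conjugate to its inverse.
\<close>

lemma no_occ_in_inverse_power:
  assumes g: "cyc_reduced g" "g \<noteq> 1"
  shows "word (inverse g ^ n) \<noteq> u @ word g @ v"
proof
  assume w: "word (inverse g ^ n) = u @ word g @ v"
  define a \<beta> where "a = inverse g" and "\<beta> = fgroup_of u"
  have a: "cyc_reduced a" "len a = len g" using g by (simp_all add: a_def)
  have red: "reduced (u @ word g @ v)" using w by (metis reduced_word)
  then have u: "word \<beta> = u" by (simp add: \<beta>_def fgroup_of_inverse reduced_append)
  have "reduced (u @ word g)" using red by (metis append.assoc reduced_append)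
  then have ug: "word (\<beta> * g) = u @ word g"
    by (simp add: times_fgroup.rep_eq u reduce_reduced)
  have lcp_app: "lcp r (r @ s) = length r" for r s :: "'a letter list"
    by (induction r) auto
  have L: "len g > 0" using g by (metis len_eq_0 neq0_conv)
  have 1: "gp \<beta> (a ^ n) = len \<beta>" "gp (\<beta> * g) (a ^ n) = len \<beta> + len g"
    "len (\<beta> * g) = len \<beta> + len g"
    using lcp_app[of u] lcp_app[of "u @ word g" v] by (simp_all add: gp_def w a_def u ug len_def)
  have 2: "len \<beta> + len a \<le> n * len a"
    using 1(2) gp_le2[of "\<beta> * g" "a ^ n"] len_power_cyc_reduced[OF a(1), of n] a(2) by linarith
  have "\<beta> \<noteq> 1"
  proof
    assume "\<beta> = 1"
    then have "gp g (inverse g ^ n) = len g" using 1 by (simp add: a_def)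
    then show False using gp_power_inverse_power_cyc_reduced[OF g(1), of 1 n] L by simp
  qed
  then have "len (a * \<beta>) = len \<beta> + len a" "gp (a * \<beta>) (a ^ n) = len \<beta> + len a"
    using power_axis_shift[OF a(1) 1(1) _ 2] by blast+
  moreover have "min (gp (a * \<beta>) (a ^ n)) (gp (a ^ n) (\<beta> * g)) \<le> gp (a * \<beta>) (\<beta> * g)"
    by (rule gp_ultrametric)
  ultimately have "a * \<beta> = \<beta> * g"
    using 1 a(2) by (intro eq_of_gp) (simp_all add: gp_commute[of "a ^ n"])
  then have "\<beta> * g * inverse \<beta> = a * \<beta> * inverse \<beta>" by simp
  then have "\<beta> * g * inverse \<beta> = inverse g" by (simp add: a_def mult.assoc)
  then show False using conj_not_inverse g by blast
qed

lemma brooks_power: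
  assumes g: "cyc_reduced g" "g \<noteq> 1"
  shows "int n \<le> brooks (word g) (g ^ n)"
proof -
  have p: "word g \<noteq> []" using g by (metis len_def len_eq_0 list.size(3))
  have "occ (word g) n (word (g ^ n))"
  proof (induction n)
    case (Suc n)
    then show ?case
      using occ_Suc[of "word g" n "word (g ^ n)" "[]"] word_power_cyc_reduced[OF g(1), of n]
      by (simp del: power_Suc)
  qed (rule occ_0)
  then have "n \<le> cnt (word g) (word (g ^ n))" using occ_le_cnt[OF p] by blast
  moreover have "cnt (word g) (winv (word (g ^ n))) = 0"
  proof (rule ccontr)
    assume "\<not> ?thesis"
    moreover have "occ (word g) (cnt (word g) (winv (word (g ^ n)))) (winv (word (g ^ n)))"
      by (rule occ_cnt[OF p])
    ultimately obtain u v where "winv (word (g ^ n)) = u @ word g @ v"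
      using occ_imp_factor by blast
    then show False
      using no_occ_in_inverse_power[OF g, of n u v] by (simp add: word_inverse[symmetric] inverse_power_group)
  qed
  ultimately show ?thesis by (simp add: brooks_def)
qed

text \<open>
  A closure-friendly substitute for membership in the commutator subgroup: all that is used of a
  product of commutators is that quasimorphisms are bounded on its values, uniformly in the values of
  the letters.
\<close>

definition balanced :: "'i letter list \<Rightarrow> bool" where
  "balanced w \<longleftrightarrow> (\<exists>R. \<forall>A :: 'i \<Rightarrow> 'i fgroup. \<forall>h. quasimorphism h \<longrightarrow> \<bar>h (ev A w)\<bar> \<le> R)"

lemma quasimorphismD:
  assumes "quasimorphism h"
  shows "h (inverse x) = - h x" "\<bar>h (x * y) - h x - h y\<bar> \<le> 3"
  using assms by (auto simp: quasimorphism_def)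

lemma balanced_append:
  assumes "balanced u" "balanced v"
  shows "balanced (u @ v)"
proof -
  obtain R S where *: "\<And>(A :: 'a \<Rightarrow> 'a fgroup) h. quasimorphism h \<Longrightarrow> \<bar>h (ev A u)\<bar> \<le> R"
    "\<And>(A :: 'a \<Rightarrow> 'a fgroup) h. quasimorphism h \<Longrightarrow> \<bar>h (ev A v)\<bar> \<le> S"
    using assms unfolding balanced_def by blast
  have "\<bar>h (ev A (u @ v))\<bar> \<le> R + S + 3" if "quasimorphism h" for A :: "'a \<Rightarrow> 'a fgroup" and h
  proof -
    have "\<bar>h (ev A u)\<bar> \<le> R" "\<bar>h (ev A v)\<bar> \<le> S" by (rule *, rule that)+
    then show ?thesis
      using quasimorphismD(2)[OF that, of "ev A u" "ev A v"] unfolding ev_append by linarith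
  qed
  then show ?thesis unfolding balanced_def by blast
qed

lemma balanced_Nil: "balanced []"
proof -
  have "\<bar>h (1 :: 'a fgroup)\<bar> \<le> 3" if "quasimorphism h" for h
    using quasimorphismD(2)[OF that, of 1 1] by simp
  then show ?thesis unfolding balanced_def by auto
qed

lemma balanced_wpow: "balanced w \<Longrightarrow> balanced (wpow w n)"
  by (induction n) (simp_all add: wpow_def balanced_Nil balanced_append)

lemma balanced_commutator: "balanced (u @ v @ winv u @ winv v)"
proof -
  have "\<bar>h (ev A (u @ v @ winv u @ winv v))\<bar> \<le> 9"
    if h: "quasimorphism h" for A :: "'a \<Rightarrow> 'a fgroup" and h
  proof -
    define x y where "x = ev A u" and "y = ev A v"
    note q = quasimorphismD[OF h]
    show ?thesis
      using q(2)[of x "y * (inverse x * inverse y)"] q(2)[of y "inverse x * inverse y"]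
        q(2)[of "inverse x" "inverse y"] q(1)[of x] q(1)[of y]
      by (simp add: x_def[symmetric] y_def[symmetric])
  qed
  then show ?thesis unfolding balanced_def by blast
qed

text \<open>
  The counting quasimorphism for the cyclically reduced conjugate of \<open>g\<close> is at least \<open>i\<close> on the \<open>i\<close>-th
  power, but its value on a balanced word is bounded independently of \<open>g\<close>.
\<close>

lemma balanced_root_bound:
  assumes "balanced w"
  obtains R where "R \<ge> 0"
    "\<And>(A :: 'i \<Rightarrow> 'i fgroup) g i. ev A w = g powi i \<Longrightarrow> g \<noteq> 1 \<Longrightarrow> \<bar>i\<bar> \<le> R"
proof -
  obtain R where R: "\<And>(A :: 'i \<Rightarrow> 'i fgroup) h. quasimorphism h \<Longrightarrow> \<bar>h (ev A w)\<bar> \<le> R"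
    using assms unfolding balanced_def by blast
  have nat: "int n \<le> R" if "ev A w = g ^ n" "g \<noteq> 1" for A :: "'i \<Rightarrow> 'i fgroup" and g n
  proof -
    obtain x where x: "cyc_reduced (x * g * inverse x)" using exists_cyc_reduced_conj by blast
    define g1 where "g1 = x * g * inverse x"
    have g1: "cyc_reduced g1" "g1 \<noteq> 1"
      using x that(2) ell_conj[of x g] unfolding g1_def by (simp_all flip: ell_eq_0)
    have "ev (\<lambda>i. x * A i * inverse x) w = g1 ^ n"
      by (simp only: ev_conj that(1) g1_def conj_power)
    moreover have "word g1 \<noteq> []" using g1 by (metis len_def len_eq_0 list.size(3))
    ultimately show ?thesis
      using R[OF quasimorphism_brooks, of "word g1" "\<lambda>i. x * A i * inverse x"] brooks_power[OF g1, of n]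
      by simp
  qed
  have "\<bar>i\<bar> \<le> max R 0" if "ev A w = g powi i" "g \<noteq> 1" for A :: "'i \<Rightarrow> 'i fgroup" and g i
  proof (cases "i \<ge> 0")
    case True
    then show ?thesis using nat[of A g "nat i"] that by (simp add: power_int_def)
  next
    case False
    then show ?thesis using nat[of A "inverse g" "nat (- i)"] that by (simp add: power_int_def)
  qed
  then show ?thesis using that[of "max R 0"] by simp
qed

section \<open>A word that controls the size of a tuple\<close>

text \<open>
  With commuting values \<open>g powi i\<close> and \<open>g powi j\<close> the exponent of the product is \<open>30 * i + q * j\<close>. Since
  \<open>\<bar>i\<bar>\<close> is bounded by a constant of the word \<open>u\<close>, this exponent cannot vanish for large \<open>q\<close>, unless both
  values are trivial.
\<close>

lemma combine_balanced_words:
  fixes u v :: "'i letter list"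
  assumes "balanced u" "balanced v"
  obtains p q K where
    "\<And>A :: 'i \<Rightarrow> 'i fgroup. ell (ev A u) \<le> K * ell (ev A (wpow u p @ wpow v q))"
    "\<And>A :: 'i \<Rightarrow> 'i fgroup. ell (ev A v) \<le> K * ell (ev A (wpow u p @ wpow v q))"
proof -
  obtain R where R: "R \<ge> 0"
    "\<And>(A :: 'i \<Rightarrow> 'i fgroup) g i. ev A u = g powi i \<Longrightarrow> g \<noteq> 1 \<Longrightarrow> \<bar>i\<bar> \<le> R"
    using balanced_root_bound[OF assms(1)] by blast
  obtain S where S: "S \<ge> 0"
    "\<And>(A :: 'i \<Rightarrow> 'i fgroup) g i. ev A v = g powi i \<Longrightarrow> g \<noteq> 1 \<Longrightarrow> \<bar>i\<bar> \<le> S"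
    using balanced_root_bound[OF assms(2)] by blast
  define q where "q = 30 * Suc (nat R)"
  define K where "K = Suc (nat R + nat S)"
  have "ell (ev A u) \<le> K * ell (ev A (wpow u 30 @ wpow v q))
      \<and> ell (ev A v) \<le> K * ell (ev A (wpow u 30 @ wpow v q))" for A :: "'i \<Rightarrow> 'i fgroup"
  proof -
    define x y where "x = ev A u" and "y = ev A v"
    have "ell x \<le> K * ell (x ^ 30 * y ^ q) \<and> ell y \<le> K * ell (x ^ 30 * y ^ q)"
    proof (cases "commute x y")
      case False
      have "ell x \<le> ell (x ^ 30 * y ^ q) \<and> ell y \<le> ell (x ^ 30 * y ^ q)"
        by (rule max_ell_le_product_of_powers[OF False]) (simp_all add: q_def)
      then show ?thesis by (simp add: K_def)
    next
      case True
      obtain g i j where g: "x = g powi i" "y = g powi j"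
        using commute_common_root[OF True] by blast
      show ?thesis
      proof (cases "g = 1 \<or> (i = 0 \<and> j = 0)")
        case True
        then have "x = 1" "y = 1" unfolding g powi_eq_one_iff by blast+
        then show ?thesis by simp
      next
        case False
        have i: "\<bar>i\<bar> \<le> R" using R(2)[of A g i] g(1) False by (simp add: x_def)
        have j: "\<bar>j\<bar> \<le> S" using S(2)[of A g j] g(2) False by (simp add: y_def)
        have "x ^ 30 * y ^ q = g powi (i * int 30 + j * int q)"
          unfolding g powi_add powi_mult by (simp only: power_int_of_nat)
        then have e: "ell (x ^ 30 * y ^ q) = nat \<bar>i * int 30 + j * int q\<bar> * ell g"
          by (simp only: ell_powi)
        have "i * int 30 + j * int q \<noteq> 0"
        proof
          assume eq: "i * int 30 + j * int q = 0"
          have "int q = 30 * (R + 1)" using R(1) by (simp add: q_def)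
          then have "30 * (i + j * (R + 1)) = 0" using eq by (simp add: algebra_simps)
          then have "i = - (j * (R + 1))" by (simp add: eq_neg_iff_add_eq_0)
          then have ij: "\<bar>i\<bar> = \<bar>j\<bar> * (R + 1)" using R(1) by (simp add: abs_mult)
          have "j \<noteq> 0" using ij False by auto
          then have "1 * (R + 1) \<le> \<bar>j\<bar> * (R + 1)" using R(1) by (intro mult_right_mono) auto
          then have "R + 1 \<le> \<bar>i\<bar>" by (simp only: ij mult_1)
          then show False using i by linarith
        qed
        then have "1 \<le> nat \<bar>i * int 30 + j * int q\<bar>" by linarith
        then have "1 * ell g \<le> nat \<bar>i * int 30 + j * int q\<bar> * ell g" by (rule mult_right_mono) simp
        then have le: "ell g \<le> ell (x ^ 30 * y ^ q)" by (simp only: e mult_1)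
        have K: "nat \<bar>i\<bar> \<le> K" "nat \<bar>j\<bar> \<le> K" using i j R(1) S(1) by (simp_all add: K_def nat_le_iff)
        have "ell x = nat \<bar>i\<bar> * ell g" "ell y = nat \<bar>j\<bar> * ell g" by (simp_all only: g ell_powi)
        then show ?thesis using mult_le_mono[OF K(1) le] mult_le_mono[OF K(2) le] by (simp only: simp_thms)
      qed
    qed
    then show ?thesis by (simp add: x_def y_def)
  qed
  then show ?thesis using that by blast
qed

lemma dominating_word:
  fixes ws :: "'i letter list list"
  assumes "\<And>w. w \<in> set ws \<Longrightarrow> balanced w \<and> set w \<subseteq> X \<times> UNIV"
  shows "\<exists>c K. balanced c \<and> set c \<subseteq> X \<times> UNIV
    \<and> (\<forall>A :: 'i \<Rightarrow> 'i fgroup. \<forall>w \<in> set ws. ell (ev A w) \<le> K * ell (ev A c))"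
  using assms
proof (induction ws)
  case Nil
  show ?case by (rule exI[of _ "[]"]) (simp add: balanced_Nil)
next
  case (Cons w ws)
  have "\<exists>c K. balanced c \<and> set c \<subseteq> X \<times> UNIV
      \<and> (\<forall>A :: 'i \<Rightarrow> 'i fgroup. \<forall>w \<in> set ws. ell (ev A w) \<le> K * ell (ev A c))"
    by (rule Cons.IH, rule Cons.prems, rule list.set_intros(2))
  then obtain c K where c: "balanced c" "set c \<subseteq> X \<times> UNIV"
    "\<forall>A :: 'i \<Rightarrow> 'i fgroup. \<forall>v \<in> set ws. ell (ev A v) \<le> K * ell (ev A c)"
    by (elim exE conjE)
  have w: "balanced w" "set w \<subseteq> X \<times> UNIV" using Cons.prems[of w] by simp_all
  obtain p q K' where K':
    "\<And>A :: 'i \<Rightarrow> 'i fgroup. ell (ev A w) \<le> K' * ell (ev A (wpow w p @ wpow c q))"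
    "\<And>A :: 'i \<Rightarrow> 'i fgroup. ell (ev A c) \<le> K' * ell (ev A (wpow w p @ wpow c q))"
    by (rule combine_balanced_words[OF w(1) c(1)], rule that)
  define d where "d = wpow w p @ wpow c q"
  have "balanced d" "set d \<subseteq> X \<times> UNIV"
    unfolding d_def using w c(1,2) set_wpow_subset[of w X p] set_wpow_subset[of c X q]
    by (simp_all add: balanced_append balanced_wpow)
  moreover have "ell (ev A v) \<le> (Suc K * K') * ell (ev A d)" if "v \<in> set (w # ws)"
    for A :: "'i \<Rightarrow> 'i fgroup" and v
  proof (cases "v = w")
    case True
    have "ell (ev A w) \<le> K' * ell (ev A d)" unfolding d_def by (rule K'(1))
    also have "\<dots> \<le> (Suc K * K') * ell (ev A d)" by (rule mult_le_mono1) simp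
    finally show ?thesis unfolding True .
  next
    case False
    then have "v \<in> set ws" using that by simp
    then have "ell (ev A v) \<le> K * ell (ev A c)" using c(3) by blast
    also have "\<dots> \<le> K * (K' * ell (ev A d))" unfolding d_def by (rule mult_left_mono[OF K'(2)]) simp
    also have "\<dots> = (K * K') * ell (ev A d)" by (simp only: mult.assoc)
    also have "\<dots> \<le> (Suc K * K') * ell (ev A d)" by (intro mult_le_mono1) simp
    finally show ?thesis .
  qed
  ultimately have "balanced d \<and> set d \<subseteq> X \<times> UNIV
      \<and> (\<forall>A :: 'i \<Rightarrow> 'i fgroup. \<forall>v \<in> set (w # ws). ell (ev A v) \<le> (Suc K * K') * ell (ev A d))"
    by (intro conjI allI ballI)
  then show ?case by (intro exI)
qed

lemma conj_shorter:
  assumes s: "gp s x = len s" "gp s (inverse x) = len s"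
    and x: "2 * len s \<le> len x"
  shows "len (inverse s * x * s) + 2 * len s = len x"
proof -
  have 1: "len (inverse s * x) + len s = len x" using len_gp[of s x] s by simp
  have 2: "len (x * s) + len s = len x" using len_mult[of x s] s by (simp add: gp_commute)
  have "gp x (x * s) + len s = len x" using gp_left[of x s] s by (simp add: gp_commute)
  then have "len s \<le> gp x (x * s)" using x by linarith
  then have "gp s (x * s) = len s" by (rule gp_prefix[OF s(1)])
  then show ?thesis using len_gp[of s "x * s"] 2 by (simp add: mult.assoc)
qed

text \<open>
  Suppose that no conjugation lowers the largest length \<open>M\<close> of the entries. If \<open>B i\<close> has length \<open>M\<close> but
  small translation length, it begins with a path \<open>s\<close> of length \<open>M div 8\<close> and ends with its inverse. As
  conjugation by \<open>s\<close> does not help, some long entry \<open>B j\<close> fails to have this form. Then \<open>B j\<close> or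
  \<open>B i * B j\<close> suffers little cyclic cancellation.
\<close>

lemma exists_long_axis:
  fixes B :: "'i \<Rightarrow> 'a fgroup"
  assumes i: "i \<in> X" and M: "len (B i) = M" "\<And>k. k \<in> X \<Longrightarrow> len (B k) \<le> M"
    and min: "\<And>s. \<exists>k \<in> X. M \<le> len (inverse s * B k * s)"
  shows "\<exists>g. M \<le> 2 * ell g + 8 \<and> (g = B i \<or> (\<exists>j \<in> X. g = B j) \<or> (\<exists>j \<in> X. g = B i * B j))"
proof (cases "M \<le> 8")
  case False
  define k where "k = M div 8"
  have k: "1 \<le> k" "8 * k \<le> M" "M < 8 * k + 8" using False by (simp_all add: k_def) 
  show ?thesis
  proof (cases "gp (B i) (inverse (B i)) < k")
    case True
    then have "M \<le> 2 * ell (B i) + 8" using len_le_ell[of "B i"] M k by linarith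
    then show ?thesis by blast
  next
    case False
    obtain s where s: "len s = k" "gp s (B i) = k" using exists_prefix[of k "B i"] M k by auto
    have si: "gp s (inverse (B i)) = k"
      using gp_prefix[of s "B i" "inverse (B i)"] s False by simp
    \<comment> \<open>Conjugation by \<open>s\<close> adds at most \<open>2 * k\<close> to a length, so only entries of length at least
      \<open>6 * k\<close> can prevent an improvement.\<close>
    obtain j where j: "j \<in> X" "M \<le> len (inverse s * B j * s)" using min by blast
    have upper: "len (inverse s * B j * s) \<le> len (B j) + 2 * k"
      using len_mult_le[of "inverse s * B j" s] len_mult_le[of "inverse s" "B j"] s by simp
    then have Bj: "6 * k \<le> len (B j)" using j k by linarith
    have "gp s (B j) < k \<or> gp s (inverse (B j)) < k"
    proof (rule ccontr)
      assume "\<not> ?thesis"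
      then have "gp s (B j) = len s" "gp s (inverse (B j)) = len s"
        using gp_le1[of s "B j"] gp_le1[of s "inverse (B j)"] s by linarith+
      then have "len (inverse s * B j * s) + 2 * k = len (B j)"
        using conj_shorter[of s "B j"] s Bj by simp
      then show False using j M(2)[of j] k by linarith
    qed
    then consider (short) "gp (B j) (inverse (B j)) < k"
      | (both) "gp s (B j) < k" "gp s (inverse (B j)) < k"
    proof -
      have "min (gp s (B j)) (gp (B j) (inverse (B j))) \<le> gp s (inverse (B j))"
        "min (gp s (inverse (B j))) (gp (inverse (B j)) (B j)) \<le> gp s (B j)"
        by (rule gp_ultrametric)+
      then show ?thesis
        using that \<open>gp s (B j) < k \<or> gp s (inverse (B j)) < k\<close> gp_commute[of "B j"] by fastforce
    qed
    then show ?thesis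
    proof cases
      case short
      then have "M \<le> 2 * ell (B j) + 8" using len_le_ell[of "B j"] Bj k by linarith
      then show ?thesis using j by blast
    next
      case both
      define g where "g = B i * B j"
      have "min (gp s (inverse (B i))) (gp (inverse (B i)) (B j)) \<le> gp s (B j)"
        by (rule gp_ultrametric)
      then have c: "gp (inverse (B i)) (B j) < k" using si both by linarith
      have lg: "len g + 2 * k > M + len (B j)" using len_mult[of "B i" "B j"] c M by (simp add: g_def)
      have 1: "k < gp (B i) g" using gp_left[of "B i" "B j"] c M k by (simp add: g_def)
      have 2: "k < gp (inverse (B j)) (inverse g)"
        using gp_left[of "inverse (B j)" "inverse (B i)"] c Bj k
        by (simp add: g_def gp_commute[of "B j"])
      have "gp g (inverse g) < k"
      proof (rule ccontr)
        assume "\<not> ?thesis"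
        moreover have "min (gp s (B i)) (gp (B i) g) \<le> gp s g"
          "min (gp s g) (gp g (inverse g)) \<le> gp s (inverse g)"
          "min (gp s (inverse g)) (gp (inverse g) (inverse (B j))) \<le> gp s (inverse (B j))"
          by (rule gp_ultrametric)+
        ultimately show False
          using s 1 2 both gp_commute[of "inverse g" "inverse (B j)"] by linarith
      qed
      then have "M \<le> 2 * ell g + 8" using len_le_ell[of g] lg Bj k by linarith
      then show ?thesis using j by (auto simp: g_def)
    qed
  qed
qed (auto intro!: exI[of _ "B i"])

text \<open>
  The vertex \<open>x\<close> is chosen such that the largest displacement of \<open>x\<close> by an entry is as small as possible.
\<close>

lemma exists_basepoint:
  fixes A :: "'i \<Rightarrow> 'a fgroup"
  assumes X: "finite X" "X \<noteq> {}"
  obtains x g where "\<And>k. k \<in> X \<Longrightarrow> len (inverse x * A k * x) \<le> 2 * ell g + 8"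
    "(\<exists>i \<in> X. g = A i) \<or> (\<exists>i \<in> X. \<exists>j \<in> X. g = A i * A j)"
proof -
  define M where "M x = Max ((\<lambda>k. len (inverse x * A k * x)) ` X)" for x
  obtain x where x: "\<And>y. M x \<le> M y"
    using ex_has_least_nat[of "\<lambda>_. True" 1 M] by blast
  define B where "B k = inverse x * A k * x" for k
  have fin: "finite ((\<lambda>k. len (inverse y * A k * y)) ` X)"
    "(\<lambda>k. len (inverse y * A k * y)) ` X \<noteq> {}" for y using X by auto
  obtain i where i: "i \<in> X" "len (B i) = M x"
    using Max_in[OF fin[of x]] by (auto simp: M_def B_def)
  have le: "len (B k) \<le> M x" if "k \<in> X" for k
    using Max_ge[OF fin(1)[of x]] that by (auto simp: M_def B_def)
  have min: "\<exists>k \<in> X. M x \<le> len (inverse s * B k * s)" for s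
  proof -
    obtain k where "k \<in> X" "M (x * s) = len (inverse (x * s) * A k * (x * s))"
      using Max_in[OF fin[of "x * s"]] by (auto simp: M_def)
    then show ?thesis using x[of "x * s"] by (auto simp: B_def mult.assoc intro!: bexI[of _ k])
  qed
  obtain g where g: "M x \<le> 2 * ell g + 8"
    "g = B i \<or> (\<exists>j \<in> X. g = B j) \<or> (\<exists>j \<in> X. g = B i * B j)"
    using exists_long_axis[OF i(1,2) le min] by blast
  define h where "h = x * g * inverse x"
  have "ell h = ell g" by (simp only: h_def ell_conj)
  then have "len (inverse x * A k * x) \<le> 2 * ell h + 8" if "k \<in> X" for k
    using le[OF that] g(1) by (simp add: B_def)
  moreover have "(\<exists>i \<in> X. h = A i) \<or> (\<exists>i \<in> X. \<exists>j \<in> X. h = A i * A j)"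
    using g(2)
  proof (elim disjE bexE)
    assume "g = B i"
    then have "h = A i" by (simp add: h_def B_def mult.assoc)
    then show ?thesis using i(1) by blast
  next
    fix j assume "j \<in> X" "g = B j"
    then have "h = A j" by (simp add: h_def B_def mult.assoc)
    then show ?thesis using \<open>j \<in> X\<close> by blast
  next
    fix j assume "j \<in> X" "g = B i * B j"
    then have "h = A i * A j" by (simp add: h_def B_def mult.assoc)
    then show ?thesis using i(1) \<open>j \<in> X\<close> by blast
  qed
  ultimately show ?thesis using that by blast
qed

text \<open>
  The commutator is a product of 30th powers of \<open>g\<close> and of a conjugate of its inverse, and by
  malnormality these two do not commute.
\<close>

lemma ell_le_commutator:
  assumes "\<not> commute g h"
  shows "ell g \<le> ell (g ^ 30 * h * inverse (g ^ 30) * inverse h)"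
proof -
  have "g \<noteq> 1" using assms by auto
  then have "\<not> commute g (h * inverse g * inverse h)"
    using centralizer_malnormal[of g "inverse g" h] assms by auto
  then have "ell g \<le> ell (g ^ 30 * (h * inverse g * inverse h) ^ 30)"
    using max_ell_le_product_of_powers[of g _ 30 30] by blast
  also have "g ^ 30 * (h * inverse g * inverse h) ^ 30 = g ^ 30 * h * inverse (g ^ 30) * inverse h"
    by (subst conj_power) (simp only: inverse_power_group mult.assoc)
  finally show ?thesis .
qed

text \<open>
  The element \<open>g\<close> of \<open>exists_basepoint\<close> depends on the tuple, and so does an entry that does not commute
  with it; hence all commutators of possible candidates are merged by \<open>dominating_word\<close>.
\<close>

theorem controlling_word:
  fixes X :: "'i set"
  assumes X: "finite X"
  obtains c K where "set c \<subseteq> X \<times> UNIV"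
    "\<And>A :: 'i \<Rightarrow> 'i fgroup. \<exists>i \<in> X. \<exists>j \<in> X. \<not> commute (A i) (A j) \<Longrightarrow>
      ev A c \<noteq> 1 \<and> (\<exists>x. \<forall>k \<in> X. len (inverse x * A k * x) \<le> K * ell (ev A c))"
proof -
  obtain xs where xs: "set xs = X" using finite_list[OF X] by blast
  define gs where "gs = map (\<lambda>i. [(i, True)]) xs
    @ concat (map (\<lambda>i. map (\<lambda>j. [(i, True), (j, True)]) xs) xs)"
  define es where "es = concat (map (\<lambda>g. map (\<lambda>h. wpow g 30 @ h @ winv (wpow g 30) @ winv h) gs) gs)"
  have gs: "set g \<subseteq> X \<times> UNIV" if "g \<in> set gs" for g
    using that by (auto simp: gs_def xs)
  have "balanced w \<and> set w \<subseteq> X \<times> UNIV" if w: "w \<in> set es" for w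
  proof -
    obtain g h where gh: "g \<in> set gs" "h \<in> set gs" "w = wpow g 30 @ h @ winv (wpow g 30) @ winv h"
      using w by (auto simp: es_def)
    show ?thesis
      unfolding gh(3)
      using balanced_commutator[of "wpow g 30" h] set_winv_subset[OF set_wpow_subset[OF gs[OF gh(1)], of 30]]
        set_winv_subset[OF gs[OF gh(2)]] set_wpow_subset[OF gs[OF gh(1)], of 30] gs[OF gh(2)]
      by simp
  qed
  then obtain c K where c: "set c \<subseteq> X \<times> UNIV"
    "\<And>(A :: 'i \<Rightarrow> 'i fgroup) w. w \<in> set es \<Longrightarrow> ell (ev A w) \<le> K * ell (ev A c)"
    using dominating_word[of es X] by blast
  have "ev A c \<noteq> 1 \<and> (\<exists>x. \<forall>k \<in> X. len (inverse x * A k * x) \<le> 10 * K * ell (ev A c))"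
    if nc: "\<exists>i \<in> X. \<exists>j \<in> X. \<not> commute (A i) (A j)" for A :: "'i \<Rightarrow> 'i fgroup"
  proof -
    have X0: "X \<noteq> {}" using nc by blast
    have pair: "ell (ev A g) \<le> K * ell (ev A c)"
      if "g \<in> set gs" "h \<in> set gs" "\<not> commute (ev A g) (ev A h)" for g h
    proof -
      have "wpow g 30 @ h @ winv (wpow g 30) @ winv h \<in> set es" using that by (auto simp: es_def)
      from c(2)[OF this, of A] show ?thesis
        using ell_le_commutator[OF that(3)] by (simp add: mult.assoc)
    qed
    have single: "[(i, True)] \<in> set gs" if "i \<in> X" for i using that by (simp add: gs_def xs)
    obtain i j where ij: "i \<in> X" "j \<in> X" "\<not> commute (A i) (A j)" using nc by blast
    have "ell (A i) \<le> K * ell (ev A c)"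
      using pair[OF single[OF ij(1)] single[OF ij(2)]] ij(3) by simp
    moreover have "ell (A i) \<noteq> 0" using ij(3) by auto
    ultimately have Kc: "K * ell (ev A c) \<ge> 1" by linarith
    then have c1: "ev A c \<noteq> 1" by auto
    obtain x g where x: "\<And>k. k \<in> X \<Longrightarrow> len (inverse x * A k * x) \<le> 2 * ell g + 8"
      and g: "(\<exists>i \<in> X. g = A i) \<or> (\<exists>i \<in> X. \<exists>j \<in> X. g = A i * A j)"
      using exists_basepoint[OF X X0, of A] by blast
    have "\<exists>w \<in> set gs. g = ev A w"
      using g
    proof
      assume "\<exists>i \<in> X. g = A i"
      then obtain i where "i \<in> X" "g = A i" by blast
      then show ?thesis using single[of i] by (intro bexI[of _ "[(i, True)]"]) simp_all
    next
      assume "\<exists>i \<in> X. \<exists>j \<in> X. g = A i * A j"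
      then obtain i j where "i \<in> X" "j \<in> X" "g = A i * A j" by blast
      then show ?thesis
        by (intro bexI[of _ "[(i, True), (j, True)]"]) (auto simp: gs_def xs)
    qed
    then obtain w where w: "w \<in> set gs" "g = ev A w" by blast
    have "ell g \<le> K * ell (ev A c)"
    proof (cases "g = 1")
      case False
      have "\<exists>k \<in> X. \<not> commute g (A k)"
      proof (rule ccontr)
        assume "\<not> ?thesis"
        then have "commute g (A i)" "commute g (A j)" using ij by blast+
        then show False using commute_trans[of g "A i" "A j"] False ij(3) by blast
      qed
      then obtain k where k: "k \<in> X" "\<not> commute g (A k)" by blast
      then show ?thesis using pair[OF w(1) single[OF k(1)]] w(2) by simp
    qed simp
    then have "len (inverse x * A k * x) \<le> 10 * K * ell (ev A c)" if "k \<in> X" for k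
      using x[OF that] Kc unfolding mult.assoc by linarith
    then show ?thesis using c1 by blast
  qed
  then show ?thesis using that[of c "10 * K"] c(1) by blast
qed

section \<open>Reading a tuple off a product with long separators\<close>

text \<open>
  Moving the vertex from which two paths are compared changes their overlap by at most the distance.
\<close>

lemma gp_translate: "gp x y \<le> gp (z * x) (z * y) + len z"
proof -
  have "len x \<le> len z + len (z * x)" "len y \<le> len z + len (z * y)"
    using len_mult_le[of "inverse z" "z * x"] len_mult_le[of "inverse z" "z * y"] by simp_all
  moreover have "inverse (z * x) * (z * y) = inverse x * y" by (simp add: mult.assoc)
  ultimately show ?thesis using len_gp[of x y] len_gp[of "z * x" "z * y"] by simp
qed

text \<open>
  The path to \<open>V\<close> does not start by running far back along the axis of \<open>C\<close>. Then a preceding factor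
  \<open>C ^ N\<close> with large \<open>N\<close> is not cancelled by \<open>V\<close>.
\<close>

definition no_backtrack :: "'a fgroup \<Rightarrow> nat \<Rightarrow> 'a fgroup \<Rightarrow> bool" where
  "no_backtrack C B V \<longleftrightarrow> (\<forall>n. gp V (inverse C ^ n) \<le> B)"

text \<open>
  The path to \<open>Y * C ^ N * V\<close> follows a long piece of the translate by \<open>Y\<close> of the axis of \<open>C\<close>. If \<open>Y\<close> does not
  commute with \<open>C\<close>, this translate shares only a short segment with the axis of \<open>C\<close> itself, by
  \<open>transversal\<close>; otherwise it is the axis of \<open>C\<close>, followed in the forward direction. The bound obtained for
  the product does not involve the bound \<open>B\<close> for \<open>V\<close>, and therefore the step can be iterated with one \<open>N\<close>.
\<close>

lemma no_backtrack_step: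
  assumes C: "cyc_reduced C" "C \<noteq> 1" and Y: "len Y \<le> \<kappa>" and V: "no_backtrack C B V"
    and N: "B + 2 * \<kappa> + 2 * len C < N * len C"
  shows "no_backtrack C (\<kappa> + 2 * len C) (Y * (C ^ N * V))"
    and "\<not> commute C Y \<Longrightarrow> gp (Y * (C ^ N * V)) (C ^ j) \<le> \<kappa> + 2 * len C"
proof -
  define P where "P = C ^ N * V"
  have "gp (inverse C ^ N) V \<le> B" using V by (simp add: no_backtrack_def gp_commute)
  then have "N * len C \<le> gp (C ^ N) P + B"
    using gp_left[of "C ^ N" V] len_power_cyc_reduced[OF C(1), of N] by (simp add: P_def inverse_power_group)
  then have near: "N * len C \<le> gp (Y * C ^ N) (Y * P) + B + \<kappa>"
    using gp_translate[of "C ^ N" P Y] Y by linarith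
  have far: "gp (Y * P) (C powi i) \<le> \<kappa> + 2 * len C" if "\<not> commute C Y" for i
  proof -
    have "gp (Y * C powi int N) (C powi i) \<le> len Y + 2 * len C" by (rule transversal[OF C that])
    then have "gp (Y * C ^ N) (C powi i) \<le> \<kappa> + 2 * len C" using Y by simp
    moreover have "min (gp (Y * C ^ N) (Y * P)) (gp (Y * P) (C powi i)) \<le> gp (Y * C ^ N) (C powi i)"
      by (rule gp_ultrametric)
    ultimately show ?thesis using near N by linarith
  qed
  show "gp (Y * (C ^ N * V)) (C ^ j) \<le> \<kappa> + 2 * len C" if "\<not> commute C Y"
    using far[OF that, of "int j"] by (simp add: P_def)
  show "no_backtrack C (\<kappa> + 2 * len C) (Y * (C ^ N * V))"
  proof (cases "commute C Y")
    case True
    then have "commute Y (C ^ N)" by (intro commute_power) (rule commute_sym)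
    then have eq: "Y * C ^ N = C ^ N * Y" by (simp add: commute_def)
    have "N * len C \<le> gp (C ^ N) (Y * C ^ N) + \<kappa>"
      unfolding eq using gp_left[of "C ^ N" Y] gp_le2[of "inverse (C ^ N)" Y] Y
        len_power_cyc_reduced[OF C(1), of N] by linarith
    moreover have "min (gp (C ^ N) (Y * C ^ N)) (gp (Y * C ^ N) (Y * P)) \<le> gp (C ^ N) (Y * P)"
      by (rule gp_ultrametric)
    ultimately have "0 < gp (C ^ N) (Y * P)" using near N by linarith
    then have "gp (Y * P) (inverse C ^ n) = 0" for n
      by (rule gp_eq_0_trans) (rule gp_power_inverse_power_cyc_reduced[OF C(1)])
    then show ?thesis by (simp add: no_backtrack_def P_def)
  next
    case False
    have "gp (Y * P) (inverse C ^ n) \<le> \<kappa> + 2 * len C" for n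
      using far[OF False, of "- int n"] by (simp add: powi_minus inverse_power_group)
    then show ?thesis by (simp add: no_backtrack_def P_def)
  qed
qed

lemma no_backtrack_terminal:
  assumes "cyc_reduced C" "C \<noteq> 1" "len Y \<le> \<kappa>" "\<not> commute C Y"
  shows "no_backtrack C (\<kappa> + 2 * len C) (Y * C powi i)"
proof -
  have "gp (Y * C powi i) (inverse C ^ n) \<le> \<kappa> + 2 * len C" for n
    using transversal[OF assms(1,2,4), of i "- int n"] assms(3)
    by (simp add: powi_minus inverse_power_group)
  then show ?thesis by (simp add: no_backtrack_def)
qed

text \<open>
  Put \<open>P = inverse Y' * z * Y\<close>, so that \<open>P * C ^ N * V = C ^ N * V'\<close>. The path to the right-hand side
  starts with a long piece of the axis of \<open>C\<close>; the path to the left-hand side does not, unless \<open>P\<close>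
  commutes with \<open>C\<close>.
\<close>

lemma peel_first_factor:
  assumes C: "cyc_reduced C" "C \<noteq> 1" and Y: "len Y \<le> \<kappa>" "len Y' \<le> \<kappa>" "len z \<le> 2 * \<kappa>"
    and V: "no_backtrack C B V" "no_backtrack C B V'"
    and N: "B + 8 * \<kappa> + 2 * len C < N * len C"
    and eq: "z * (Y * (C ^ N * V)) = Y' * (C ^ N * V')"
  shows "commute C (inverse Y' * z * Y)" "V' = inverse Y' * z * Y * V"
proof -
  define P where "P = inverse Y' * z * Y"
  have PV: "P * (C ^ N * V) = C ^ N * V'"
  proof -
    have "P * (C ^ N * V) = inverse Y' * (z * (Y * (C ^ N * V)))" by (simp add: P_def mult.assoc)
    also have "\<dots> = C ^ N * V'" by (simp only: eq inverse_mult_cancel)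
    finally show ?thesis .
  qed
  have lP: "len P \<le> 4 * \<kappa>"
    using len_mult_le[of "inverse Y' * z" Y] len_mult_le[of "inverse Y'" z] Y by (simp add: P_def)
  have "commute C P"
  proof (rule ccontr)
    assume n: "\<not> commute C P"
    have "gp (C ^ N * V') (C ^ N) \<le> 4 * \<kappa> + 2 * len C"
      using no_backtrack_step(2)[OF C lP V(1) _ n, of N N] N by (simp add: PV)
    moreover have "gp (inverse C ^ N) V' \<le> B" using V by (simp add: no_backtrack_def gp_commute)
    ultimately show False
      using gp_left[of "C ^ N" V'] len_power_cyc_reduced[OF C(1), of N] N
      by (simp add: inverse_power_group gp_commute[of "C ^ N * V'"])
  qed
  then show "commute C (inverse Y' * z * Y)" by (simp only: P_def)
  have "commute P (C ^ N)" by (intro commute_power commute_sym[OF \<open>commute C P\<close>])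
  then have "C ^ N * (P * V) = P * (C ^ N * V)"
    unfolding commute_def by (simp only: mult.assoc[symmetric])
  then have "C ^ N * (P * V) = C ^ N * V'" by (simp only: PV)
  then have "P * V = V'" by (simp only: left_cancel)
  then show "V' = inverse Y' * z * Y * V" by (simp only: P_def)
qed

text \<open>
  \<open>D\<close> between any two entries of the list makes the entries recoverable one by one; \<open>E\<close> will be a large
  power of the element whose axis is followed.
\<close>

fun alternating :: "'a :: mult_group \<Rightarrow> 'a \<Rightarrow> 'a list \<Rightarrow> 'a" where
  "alternating E D [] = D"
| "alternating E D (x # xs) = x * (E * (D * (E * alternating E D xs)))"

lemma alternating_no_backtrack:
  assumes C: "cyc_reduced C" "C \<noteq> 1" and D: "len D \<le> \<kappa>" "\<not> commute C D"
    and xs: "\<And>x. x \<in> set xs \<Longrightarrow> len x \<le> \<kappa>" and N: "3 * \<kappa> + 4 * len C < N * len C"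
  shows "no_backtrack C (\<kappa> + 2 * len C) (alternating (C ^ N) D xs * C powi i)"
  using xs
proof (induction xs)
  case Nil
  then show ?case using no_backtrack_terminal[OF C D] by simp
next
  case (Cons x xs)
  have N': "\<kappa> + 2 * len C + 2 * \<kappa> + 2 * len C < N * len C" using N by simp
  have "no_backtrack C (\<kappa> + 2 * len C) (alternating (C ^ N) D xs * C powi i)" using Cons by simp
  then have "no_backtrack C (\<kappa> + 2 * len C) (D * (C ^ N * (alternating (C ^ N) D xs * C powi i)))"
    by (rule no_backtrack_step(1)[OF C D(1) _ N'])
  then have "no_backtrack C (\<kappa> + 2 * len C)
      (x * (C ^ N * (D * (C ^ N * (alternating (C ^ N) D xs * C powi i)))))"
    by (rule no_backtrack_step(1)[OF C _ _ N', rotated]) (simp add: Cons.prems)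
  then show ?case by (simp add: mult.assoc)
qed

lemma centralizer_trivial_intersection:
  assumes "commute C P" "commute C (inverse D * P * D)" "\<not> commute C D"
  shows "P = (1 :: 'a fgroup)"
proof (rule ccontr)
  assume P: "P \<noteq> 1"
  have "C \<noteq> 1" using assms(3) by auto
  then have "commute C (inverse D)"
    using centralizer_malnormal[of C P "inverse D"] assms P by simp
  then show False using assms(3) by simp
qed

text \<open>
  Peeling off \<open>x\<close> and \<open>y\<close> leaves an element \<open>P\<close> of the centralizer of \<open>C\<close>; peeling off the following factor
  \<open>D\<close> puts its conjugate by \<open>D\<close> into the centralizer as well, and so \<open>P = 1\<close>.
\<close>

lemma alternating_inj:
  assumes C: "cyc_reduced C" "C \<noteq> 1" and D: "len D \<le> \<kappa>" "\<not> commute C D"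
    and N: "9 * \<kappa> + 4 * len C < N * len C"
    and "length xs = length ys"
    and "\<And>x. x \<in> set xs \<union> set ys \<Longrightarrow> len x \<le> \<kappa>"
    and "alternating (C ^ N) D xs = alternating (C ^ N) D ys"
  shows "xs = ys"
  using assms(6-8)
proof (induction xs ys rule: list_induct2)
  case (Cons x xs y ys)
  define B where "B = \<kappa> + 2 * len C"
  have bounds: "\<And>v. v \<in> set xs \<Longrightarrow> len v \<le> \<kappa>" "\<And>v. v \<in> set ys \<Longrightarrow> len v \<le> \<kappa>"
    "len x \<le> \<kappa>" "len y \<le> \<kappa>" using Cons.prems by auto
  have N1: "3 * \<kappa> + 4 * len C < N * len C" "B + 2 * \<kappa> + 2 * len C < N * len C"
    "B + 8 * \<kappa> + 2 * len C < N * len C" using N by (simp_all add: B_def)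
  define V W where "V = alternating (C ^ N) D xs" and "W = alternating (C ^ N) D ys"
  have VW: "no_backtrack C B V" "no_backtrack C B W"
    using alternating_no_backtrack[OF C D bounds(1) N1(1), where i = 0]
      alternating_no_backtrack[OF C D bounds(2) N1(1), where i = 0]
    by (simp_all add: B_def V_def W_def)
  have VW': "no_backtrack C B (D * (C ^ N * V))" "no_backtrack C B (D * (C ^ N * W))"
    unfolding B_def
    by (rule no_backtrack_step(1)[OF C D(1)], (rule VW), (rule N1))+
  define P where "P = inverse y * x"
  have "1 * (x * (C ^ N * (D * (C ^ N * V)))) = y * (C ^ N * (D * (C ^ N * W)))"
    using Cons.prems(2) by (simp add: V_def W_def)
  from peel_first_factor[OF C bounds(3,4) _ VW' N1(3) this]
  have P: "commute C P" "P * (D * (C ^ N * V)) = D * (C ^ N * W)" by (simp_all add: P_def)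
  have "len P \<le> 2 * \<kappa>"
    using len_mult_le[of "inverse y" x] bounds by (simp add: P_def)
  from peel_first_factor[OF C D(1) D(1) this VW N1(3) P(2)]
  have Q: "commute C (inverse D * P * D)" "W = inverse D * P * D * V" by simp_all
  have "P = 1" by (rule centralizer_trivial_intersection[OF P(1) Q(1) D(2)])
  then have "x = y" "V = W"
    using Q(2) by (auto simp: P_def dest: inverse_unique_group)
  then show ?case using Cons by (simp add: V_def W_def)
qed simp

text \<open>
  The two leading factors \<open>D\<close> allow \<open>D\<close> itself to be read off before the list.
\<close>

definition separated_product :: "'a :: mult_group \<Rightarrow> 'a \<Rightarrow> 'a list \<Rightarrow> 'a" where
  "separated_product E D xs = D * (E * (D * (E * alternating E D xs)))"

lemma separated_product_inj:
  assumes C: "cyc_reduced C" "C \<noteq> 1" and D: "len D \<le> \<kappa>" "\<not> commute C D"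
    and D': "len D' \<le> \<kappa>" "\<not> commute C D'"
    and N: "9 * \<kappa> + 4 * len C < N * len C"
    and len: "length xs = length ys"
    and bounds: "\<And>x. x \<in> set xs \<union> set ys \<Longrightarrow> len x \<le> \<kappa>"
    and eq: "separated_product (C ^ N) D xs = separated_product (C ^ N) D' ys"
  shows "xs = ys"
proof -
  define B where "B = \<kappa> + 2 * len C"
  have N1: "3 * \<kappa> + 4 * len C < N * len C" "B + 2 * \<kappa> + 2 * len C < N * len C"
    "B + 8 * \<kappa> + 2 * len C < N * len C" using N by (simp_all add: B_def)
  define V W where "V = alternating (C ^ N) D xs" and "W = alternating (C ^ N) D' ys"
  have VW: "no_backtrack C B V" "no_backtrack C B W"
    using alternating_no_backtrack[OF C D _ N1(1), of xs 0] alternating_no_backtrack[OF C D' _ N1(1), of ys 0] bounds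
    by (simp_all add: B_def V_def W_def)
  have V': "no_backtrack C B (D * (C ^ N * V))"
    unfolding B_def by (rule no_backtrack_step(1)[OF C D(1) VW(1) N1(2)])
  have W': "no_backtrack C B (D' * (C ^ N * W))"
    unfolding B_def by (rule no_backtrack_step(1)[OF C D'(1) VW(2) N1(2)])
  define P where "P = inverse D' * D"
  have "1 * (D * (C ^ N * (D * (C ^ N * V)))) = D' * (C ^ N * (D' * (C ^ N * W)))"
    using eq by (simp add: V_def W_def separated_product_def)
  from peel_first_factor[OF C D(1) D'(1) _ V' W' N1(3) this]
  have P: "commute C P" "P * (D * (C ^ N * V)) = D' * (C ^ N * W)" by (simp_all add: P_def)
  have "len P \<le> 2 * \<kappa>"
    using len_mult_le[of "inverse D'" D] D(1) D'(1) by (simp add: P_def)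
  from peel_first_factor[OF C D(1) D'(1) this VW N1(3) P(2)]
  have Q: "commute C (inverse D' * P * D)" "W = inverse D' * P * D * V" by simp_all
  have "inverse D' * P * D' = inverse D' * P * D * inverse P" by (simp add: P_def mult.assoc)
  then have "commute C (inverse D' * P * D')" using Q(1) P(1) by (simp add: commute_mult)
  then have "P = 1" by (rule centralizer_trivial_intersection[OF P(1) _ D'(2)])
  then have DD: "D = D'" by (auto simp: P_def dest: inverse_unique_group)
  then have "V = W" using Q(2) \<open>P = 1\<close> by simp
  then show ?thesis
    using alternating_inj[OF C D N len bounds] DD by (simp add: V_def W_def)
qed

lemma alternating_conj: "alternating (g * E * inverse g) (g * D * inverse g) (map (\<lambda>x. g * x * inverse g) xs)
    = g * alternating E D xs * inverse g"
  by (induction xs) (simp_all add: mult.assoc)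

lemma separated_product_conj:
  "separated_product (g * E * inverse g) (g * D * inverse g) (map (\<lambda>x. g * x * inverse g) xs)
    = g * separated_product E D xs * inverse g"
  by (simp add: separated_product_def alternating_conj) (simp add: mult.assoc)

text \<open>
  The left-hand side leaves the axis of \<open>C\<close> soon, because \<open>D\<close> does not commute with \<open>C\<close>, but the right-hand
  side follows it for about \<open>s\<close> periods. This bounds \<open>s\<close> by \<open>2 * K + 4\<close>, independently of \<open>N\<close>; so conjugation
  by \<open>C ^ s\<close> lengthens the entries by a controlled amount, and \<open>separated_product_inj\<close> applies to the
  conjugated list as soon as \<open>N\<close> is large in terms of \<open>K\<close>.
\<close>

lemma separated_product_inj_up_to_conj:
  assumes C: "cyc_reduced C" "C \<noteq> 1" and D: "len D \<le> K * len C" "\<not> commute C D"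
    and D': "len D' \<le> K * len C" "\<not> commute C D'"
    and N: "9 * (5 * K + 8) + 5 \<le> N"
    and len: "length xs = length ys"
    and bounds: "\<And>x. x \<in> set xs \<union> set ys \<Longrightarrow> len x \<le> K * len C"
    and eq: "separated_product (C ^ N) D xs
      = C ^ s * separated_product (C ^ N) D' ys * inverse (C ^ s)"
  shows "xs = map (\<lambda>y. C ^ s * y * inverse (C ^ s)) ys"
proof -
  define L where "L = len C"
  have L: "L > 0" using C by (metis L_def len_eq_0 neq0_conv)
  define B where "B = K * L + 2 * L"
  have NL: "(9 * (5 * K + 8) + 5) * L \<le> N * L" using N by (rule mult_le_mono1)
  have N1: "3 * (K * L) + 4 * L < N * L" "B + 2 * (K * L) + 2 * L < N * L"
    using NL L by (simp_all add: B_def algebra_simps)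
  have s: "s \<le> 2 * K + 4"
  proof -
    have a: "no_backtrack C B (alternating (C ^ N) D xs)"
      using alternating_no_backtrack[OF C D, of xs N 0] bounds N1(1) by (simp add: B_def L_def)
    then have "no_backtrack C B (D * (C ^ N * alternating (C ^ N) D xs))"
      using no_backtrack_step(1)[OF C D(1) a, of N] N1(2) by (simp add: B_def L_def)
    from no_backtrack_step(2)[OF C D(1) this _ D(2), of N s]
    have upper: "gp (separated_product (C ^ N) D xs) (C ^ s) \<le> B"
      using N1(2) by (simp add: B_def L_def separated_product_def)
    define V where "V = separated_product (C ^ N) D' ys * inverse (C ^ s)"
    have pi: "C powi (- int s) = inverse (C ^ s)" by (simp add: powi_minus)
    have b: "no_backtrack C B (alternating (C ^ N) D' ys * inverse (C ^ s))"
      using alternating_no_backtrack[OF C D', of ys N "- int s"] bounds N1(1)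
      by (simp add: B_def L_def pi)
    then have b: "no_backtrack C B (D' * (C ^ N * (alternating (C ^ N) D' ys * inverse (C ^ s))))"
      using no_backtrack_step(1)[OF C D'(1) b, of N] N1(2) by (simp add: B_def L_def)
    then have "no_backtrack C B (D' * (C ^ N * (D' * (C ^ N * (alternating (C ^ N) D' ys * inverse (C ^ s))))))"
      using no_backtrack_step(1)[OF C D'(1) b, of N] N1(2) by (simp add: B_def L_def)
    then have "no_backtrack C B V" by (simp add: V_def separated_product_def mult.assoc)
    then have "gp (inverse (C ^ s)) V \<le> B"
      by (simp add: no_backtrack_def gp_commute inverse_power_group)
    then have "s * L \<le> gp (C ^ s) (C ^ s * V) + B"
      using gp_left[of "C ^ s" V] len_power_cyc_reduced[OF C(1), of s] by (simp add: L_def)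
    moreover have "C ^ s * V = separated_product (C ^ N) D xs"
      using eq by (simp add: V_def mult.assoc)
    ultimately have "s * L \<le> 2 * B" using upper gp_commute[of "C ^ s"] by simp
    then have "s * L \<le> (2 * K + 4) * L" by (simp add: B_def algebra_simps)
    then show ?thesis using L by simp
  qed
  define conj where "conj y = C ^ s * y * inverse (C ^ s)" for y
  \<comment> \<open>An entry has at most \<open>K\<close> periods, and conjugation by \<open>C ^ s\<close> adds at most \<open>2 * (2 * K + 4)\<close>.\<close>
  define \<kappa> where "\<kappa> = (5 * K + 8) * L"
  have small: "len x \<le> \<kappa>" if "len x \<le> K * L" for x :: "'a fgroup"
    using that by (simp add: \<kappa>_def algebra_simps)
  have conj_small: "len (conj y) \<le> \<kappa>" if "len y \<le> K * L" for y
  proof -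
    have "len (conj y) \<le> len (C ^ s) + len y + len (C ^ s)"
      using len_mult_le[of "C ^ s * y" "inverse (C ^ s)"] len_mult_le[of "C ^ s" y]
      by (simp add: conj_def)
    moreover have "len (C ^ s) \<le> (2 * K + 4) * L"
      using len_power_cyc_reduced[OF C(1), of s] mult_le_mono1[OF s, of L] by (simp add: L_def)
    ultimately show ?thesis using that by (simp add: \<kappa>_def algebra_simps)
  qed
  have comm: "commute (C ^ s) C" "commute (C ^ s) (C ^ N)"
    using commute_sym[OF commute_power[OF commute_refl[of C], of s]] by (simp_all add: commute_power)
  then have CN: "conj (C ^ N) = C ^ N" "conj C = C"
    by (simp_all add: conj_def commute_iff_conj)
  have "separated_product (C ^ N) D xs = separated_product (conj (C ^ N)) (conj D') (map conj ys)"
    unfolding eq conj_def by (rule separated_product_conj[symmetric])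
  then have eq': "separated_product (C ^ N) D xs = separated_product (C ^ N) (conj D') (map conj ys)"
    by (simp only: CN)
  have nc: "\<not> commute C (conj D')"
    using D'(2) CN(2) commute_conj[of "C ^ s" C D'] by (simp only: conj_def[symmetric] not_False_eq_True)
  have N2: "9 * \<kappa> + 4 * len C < N * len C"
    using NL L by (simp add: \<kappa>_def L_def[symmetric] algebra_simps)
  have "xs = map conj ys"
  proof (rule separated_product_inj[OF C _ D(2) _ nc N2 _ _ eq'])
    show "len D \<le> \<kappa>" using D(1) by (intro small) (simp add: L_def)
    show "len (conj D') \<le> \<kappa>" using D'(1) by (intro conj_small) (simp add: L_def)
    show "length xs = length (map conj ys)" using len by simp
    show "len x \<le> \<kappa>" if "x \<in> set xs \<union> set (map conj ys)" for x
      using that bounds small conj_small by (auto simp: L_def)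
  qed
  then show ?thesis unfolding conj_def .
qed

subsection \<open>An element that does not commute with the separator\<close>

definition spread :: "'a :: mult_group \<Rightarrow> 'a list \<Rightarrow> 'a" where
  "spread E xs = foldr (\<lambda>x v. x * (E * v)) xs 1"

lemma spread_no_backtrack:
  assumes C: "cyc_reduced C" "C \<noteq> 1" and xs: "\<And>x. x \<in> set xs \<Longrightarrow> len x \<le> \<kappa>"
    and N: "3 * \<kappa> + 4 * len C < N * len C"
  shows "no_backtrack C (\<kappa> + 2 * len C) (spread (C ^ N) xs * C ^ n)"
  using xs
proof (induction xs)
  case Nil
  then show ?case
    using gp_power_inverse_power_cyc_reduced[OF C(1)] by (simp add: spread_def no_backtrack_def)
next
  case (Cons x xs)
  have "no_backtrack C (\<kappa> + 2 * len C) (x * (C ^ N * (spread (C ^ N) xs * C ^ n)))"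
    using Cons N by (intro no_backtrack_step(1)[OF C, where B = "\<kappa> + 2 * len C"]) simp_all
  then show ?case by (simp add: spread_def mult.assoc)
qed

text \<open>
  Factors commuting with \<open>C\<close> at the beginning can be dropped. If the first factor does not commute with \<open>C\<close>,
  then \<open>spread (C ^ N) xs * C ^ n\<close> leaves the axis of \<open>C\<close> within a bound independent of \<open>n\<close>; if the product
  commuted with \<open>C\<close>, this element would follow that axis for about \<open>n\<close> periods.
\<close>

lemma spread_not_commute:
  assumes C: "cyc_reduced C" "C \<noteq> 1" and "\<And>x. x \<in> set xs \<Longrightarrow> len x \<le> \<kappa>"
    and N: "3 * \<kappa> + 4 * len C < N * len C" and "\<exists>x \<in> set xs. \<not> commute C x"
  shows "\<not> commute C (spread (C ^ N) xs)"
  using assms(3,5)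
proof (induction xs)
  case (Cons x xs)
  define Z where "Z = spread (C ^ N) (x # xs)"
  have Z: "Z = x * (C ^ N * spread (C ^ N) xs)" by (simp add: Z_def spread_def)
  show ?case
  proof (cases "commute C x")
    case True
    then have "\<not> commute C (spread (C ^ N) xs)" using Cons by auto
    moreover have "spread (C ^ N) xs = inverse (x * C ^ N) * Z" by (simp add: Z mult.assoc)
    moreover have "commute C (inverse (x * C ^ N))"
      using True by (intro commute_inverse commute_mult commute_power commute_refl)
    ultimately show ?thesis unfolding Z_def[symmetric] by (metis commute_mult)
  next
    case False
    have L: "len C > 0" using C by (metis len_eq_0 neq0_conv)
    show ?thesis
    proof
      assume "commute C (spread (C ^ N) (x # xs))"
      then have "commute Z (C ^ n)" for n
        unfolding Z_def by (intro commute_power) (rule commute_sym)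
      then have eq: "Z * C ^ n = C ^ n * Z" for n by (simp add: commute_def)
      define n where "n = len Z + \<kappa> + 3"
      have "no_backtrack C (\<kappa> + 2 * len C) (spread (C ^ N) xs * C ^ n)"
        using spread_no_backtrack[OF C _ N, of xs] Cons.prems by simp
      from no_backtrack_step(2)[OF C _ this _ False, of \<kappa> N n]
      have "gp (Z * C ^ n) (C ^ n) \<le> \<kappa> + 2 * len C"
        using Cons.prems(1)[of x] N by (simp add: Z mult.assoc)
      then have "gp (C ^ n) (C ^ n * Z) \<le> \<kappa> + 2 * len C"
        by (simp add: eq gp_commute)
      then have "n * len C \<le> \<kappa> + 2 * len C + len Z"
        using gp_left[of "C ^ n" Z] gp_le2[of "inverse (C ^ n)" Z] len_power_cyc_reduced[OF C(1), of n]
        by linarith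
      moreover have "len Z + \<kappa> \<le> (len Z + \<kappa>) * len C" using L by simp
      ultimately show False using L by (simp add: n_def algebra_simps)
    qed
  qed
qed simp

lemma len_spread_le:
  assumes "\<And>x. x \<in> set xs \<Longrightarrow> len x \<le> \<kappa>"
  shows "len (spread E xs) \<le> length xs * (\<kappa> + len E)"
  using assms
proof (induction xs)
  case (Cons x xs)
  have "len (spread E (x # xs)) \<le> len x + (len E + len (spread E xs))"
    using len_mult_le[of x "E * spread E xs"] len_mult_le[of E "spread E xs"]
    by (simp add: spread_def)
  then show ?case using Cons by fastforce
qed (simp add: spread_def)

section \<open>Two words that determine a tuple\<close>

definition spread_word :: "'i letter list \<Rightarrow> 'i list \<Rightarrow> 'i letter list" where
  "spread_word e is = foldr (\<lambda>i w. (i, True) # e @ w) is []"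

lemma ev_spread_word: "ev A (spread_word e is) = spread (ev A e) (map A is)"
  by (induction "is") (simp_all add: spread_word_def spread_def mult.assoc)

fun alternating_word :: "'i letter list \<Rightarrow> 'i letter list \<Rightarrow> 'i list \<Rightarrow> 'i letter list" where
  "alternating_word e d [] = d"
| "alternating_word e d (i # is) = (i, True) # e @ d @ e @ alternating_word e d is"

lemma ev_alternating_word: "ev A (alternating_word e d is) = alternating (ev A e) (ev A d) (map A is)"
  by (induction "is") simp_all

definition separated_word :: "'i letter list \<Rightarrow> 'i letter list \<Rightarrow> 'i list \<Rightarrow> 'i letter list" where
  "separated_word e d is = d @ e @ d @ e @ alternating_word e d is"

lemma ev_separated_word:
  "ev A (separated_word e d is) = separated_product (ev A e) (ev A d) (map A is)"
  by (simp add: separated_word_def separated_product_def ev_alternating_word)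

lemma set_spread_word: "set (spread_word e is) \<subseteq> set e \<union> set is \<times> UNIV"
  by (induction "is") (auto simp: spread_word_def)

lemma set_alternating_word: "set (alternating_word e d is) \<subseteq> set e \<union> set d \<union> set is \<times> UNIV"
  by (induction "is") auto

lemma set_separated_word: "set (separated_word e d is) \<subseteq> set e \<union> set d \<union> set is \<times> UNIV"
  using set_alternating_word[of e d "is"] by (auto simp: separated_word_def)

text \<open>
  A vertex moved little by \<open>C\<close> is near the axis of \<open>C\<close>, hence near \<open>1\<close> after a shift by a power of \<open>C\<close>.
\<close>

lemma exists_frame:
  assumes C: "cyc_reduced C" "C \<noteq> 1" and t: "len (inverse t * C * t) \<le> K * len C"
  shows "\<exists>j :: int. \<forall>a. len (C powi j * a * inverse (C powi j)) \<le> len (inverse t * a * t) + (K + 1) * len C"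
proof -
  obtain j :: int where j: "2 * len (C powi j * t) < len (inverse t * C * t) + len C"
    using exists_near_translate[OF C] by blast
  define y where "y = C powi j * t"
  have "len (C powi j * a * inverse (C powi j)) \<le> len (inverse t * a * t) + (K + 1) * len C" for a
  proof -
    have eq: "C powi j * a * inverse (C powi j) = y * (inverse t * a * t) * inverse y"
      by (simp add: y_def mult.assoc)
    have "len (y * (inverse t * a * t) * inverse y) \<le> len y + len (inverse t * a * t) + len y"
      using len_mult_le[of "y * (inverse t * a * t)" "inverse y"] len_mult_le[of y "inverse t * a * t"]
      by simp
    moreover have "2 * len y \<le> (K + 1) * len C" using j t by (simp add: y_def)
    ultimately show ?thesis unfolding eq by linarith
  qed
  then show ?thesis by blast
qed

text \<open>
  The constants are chosen in order: \<open>k1\<close> bounds the entries near the axis of \<open>C\<close>, which gives \<open>M\<close> and the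
  word \<open>d\<close>; \<open>k2\<close> bounds the entries and the value of \<open>d\<close>, which gives \<open>N\<close> and the second word \<open>u\<close>.
\<close>

theorem two_words_determine:
  fixes X :: "'i set"
  assumes X: "finite X"
  shows "\<exists>u1 u2. set u1 \<subseteq> X \<times> UNIV \<and> set u2 \<subseteq> X \<times> UNIV
    \<and> (\<forall>A B :: 'i \<Rightarrow> 'i fgroup.
        (\<exists>i \<in> X. \<exists>j \<in> X. \<not> commute (A i) (A j)) \<longrightarrow> (\<exists>i \<in> X. \<exists>j \<in> X. \<not> commute (B i) (B j)) \<longrightarrow>
        ev A u1 = ev B u1 \<longrightarrow> ev A u2 = ev B u2 \<longrightarrow> (\<forall>i \<in> X. A i = B i))"
proof -
  obtain c K where c: "set c \<subseteq> X \<times> UNIV"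
    and K: "\<And>A :: 'i \<Rightarrow> 'i fgroup. \<exists>i \<in> X. \<exists>j \<in> X. \<not> commute (A i) (A j) \<Longrightarrow>
      ev A c \<noteq> 1 \<and> (\<exists>x. \<forall>k \<in> X. len (inverse x * A k * x) \<le> K * ell (ev A c))"
    using controlling_word[OF X] by blast
  obtain xs where xs: "set xs = X" using finite_list[OF X] by blast
  define k1 where "k1 = K + (length c * K + 1)"
  define M where "M = 3 * k1 + 5"
  define k2 where "k2 = length xs * (k1 + M) + k1"
  define N where "N = 9 * (5 * k2 + 8) + 5"
  define d where "d = spread_word (wpow c M) xs"
  define u where "u = separated_word (wpow c N) d xs"
  define good where "good A C \<longleftrightarrow> ev A c = C \<and> (\<forall>i \<in> X. len (A i) \<le> k1 * len C)
    \<and> (\<exists>i \<in> X. \<not> commute C (A i))" for A :: "'i \<Rightarrow> 'i fgroup" and C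
  have d_good: "len (ev A d) \<le> k2 * len C \<and> \<not> commute C (ev A d)"
    if C: "cyc_reduced C" "C \<noteq> 1" and A: "good A C" for A :: "'i \<Rightarrow> 'i fgroup" and C
  proof -
    have L: "len C > 0" using C by (metis len_eq_0 neq0_conv)
    have ed: "ev A d = spread (C ^ M) (map A xs)"
      using A by (simp add: d_def ev_spread_word good_def)
    have small: "len x \<le> k1 * len C" if "x \<in> set (map A xs)" for x
      using A that xs by (auto simp: good_def)
    have "len (spread (C ^ M) (map A xs)) \<le> length (map A xs) * (k1 * len C + len (C ^ M))"
      by (rule len_spread_le[OF small])
    also have "\<dots> \<le> k2 * len C"
      using len_power_cyc_reduced[OF C(1), of M] by (simp add: k2_def algebra_simps)
    moreover have "\<not> commute C (spread (C ^ M) (map A xs))"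
    proof (rule spread_not_commute[OF C small])
      show "3 * (k1 * len C) + 4 * len C < M * len C" using L by (simp add: M_def algebra_simps)
      show "\<exists>x \<in> set (map A xs). \<not> commute C x" using A xs by (auto simp: good_def)
    qed
    ultimately show ?thesis by (simp add: ed)
  qed
  have exists_good: "\<exists>j :: int. good (\<lambda>i. C powi j * A i * inverse (C powi j)) C"
    if nc: "\<exists>i \<in> X. \<exists>j \<in> X. \<not> commute (A i) (A j)" and C: "ev A c = C" "cyc_reduced C"
    for A :: "'i \<Rightarrow> 'i fgroup" and C
  proof -
    obtain x where C1: "C \<noteq> 1" and x: "\<And>k. k \<in> X \<Longrightarrow> len (inverse x * A k * x) \<le> K * len C"
      using K[OF nc] C by (auto simp: cyc_reduced_iff_ell)
    have "inverse x * C * x = ev (\<lambda>i. inverse x * A i * inverse (inverse x)) c"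
      using ev_conj[of "inverse x" A c] by (simp only: C inverse_inverse_group)
    moreover have "len (ev (\<lambda>i. inverse x * A i * inverse (inverse x)) c) \<le> length c * (K * len C)"
      using c x by (intro len_ev_le) auto
    ultimately have "len (inverse x * C * x) \<le> (length c * K) * len C" by (simp add: mult.assoc)
    from exists_frame[OF C(2) C1 this] obtain j :: int where
      j: "\<And>a. len (C powi j * a * inverse (C powi j)) \<le> len (inverse x * a * x) + (length c * K + 1) * len C"
      by blast
    have CC: "C powi j * C * inverse (C powi j) = C"
      using commute_iff_conj[of "C powi j" C] commute_sym[OF commute_powi[OF commute_refl[of C], of j]] by simp
    have "len (C powi j * A i * inverse (C powi j)) \<le> k1 * len C" if "i \<in> X" for i
      using j[of "A i"] x[OF that] unfolding k1_def add_mult_distrib by linarith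
    moreover have "\<exists>i \<in> X. \<not> commute C (C powi j * A i * inverse (C powi j))"
    proof (rule ccontr)
      assume "\<not> ?thesis"
      then have "commute (C powi j * C * inverse (C powi j)) (C powi j * A i * inverse (C powi j))"
        if "i \<in> X" for i using that by (simp only: CC) blast
      then have "commute C (A i)" if "i \<in> X" for i using that by (simp only: commute_conj)
      then show False using nc commute_trans[OF _ _ C1] by blast
    qed
    ultimately have "good (\<lambda>i. C powi j * A i * inverse (C powi j)) C"
      unfolding good_def ev_conj C(1) CC by blast
    then show ?thesis by blast
  qed
  have aligned: "\<forall>i \<in> X. A i = C ^ s * B i * inverse (C ^ s)"
    if C: "cyc_reduced C" "C \<noteq> 1" and A: "good A C" and B: "good B C"
      and eq: "ev A u = C ^ s * ev B u * inverse (C ^ s)" for A B :: "'i \<Rightarrow> 'i fgroup" and C s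
  proof -
    have ev_u: "ev A u = separated_product (C ^ N) (ev A d) (map A xs)"
      "ev B u = separated_product (C ^ N) (ev B d) (map B xs)"
      using A B by (simp_all add: u_def ev_separated_word good_def)
    have bounds: "len x \<le> k2 * len C" if x: "x \<in> set (map A xs) \<union> set (map B xs)" for x
    proof -
      have "len x \<le> k1 * len C" using A B x xs by (auto simp: good_def)
      also have "\<dots> \<le> k2 * len C" by (rule mult_le_mono1) (simp add: k2_def)
      finally show ?thesis .
    qed
    have dA: "len (ev A d) \<le> k2 * len C" "\<not> commute C (ev A d)" using d_good[OF C A] by simp_all
    have dB: "len (ev B d) \<le> k2 * len C" "\<not> commute C (ev B d)" using d_good[OF C B] by simp_all
    have "map A xs = map (\<lambda>y. C ^ s * y * inverse (C ^ s)) (map B xs)"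
      by (rule separated_product_inj_up_to_conj[OF C dA dB _ _ bounds eq[unfolded ev_u]])
        (simp_all add: N_def)
    then show ?thesis using xs by auto
  qed
  have determined: "\<forall>i \<in> X. A i = B i"
    if nA: "\<exists>i \<in> X. \<exists>j \<in> X. \<not> commute (A i) (A j)" and nB: "\<exists>i \<in> X. \<exists>j \<in> X. \<not> commute (B i) (B j)"
      and eq: "ev A c = ev B c" "ev A u = ev B u" for A B :: "'i \<Rightarrow> 'i fgroup"
  proof -
    obtain x where x: "cyc_reduced (x * ev A c * inverse x)" using exists_cyc_reduced_conj by blast
    define C where "C = x * ev A c * inverse x"
    define A1 B1 where "A1 = (\<lambda>i. x * A i * inverse x)" and "B1 = (\<lambda>i. x * B i * inverse x)"
    have C: "cyc_reduced C" "ev A1 c = C" "ev B1 c = C"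
      using x by (simp_all add: C_def A1_def B1_def ev_conj eq)
    have eq1: "ev A1 u = ev B1 u" by (simp add: A1_def B1_def ev_conj eq)
    have nA1: "\<exists>i \<in> X. \<exists>j \<in> X. \<not> commute (A1 i) (A1 j)"
      and nB1: "\<exists>i \<in> X. \<exists>j \<in> X. \<not> commute (B1 i) (B1 j)"
      using nA nB by (simp_all add: A1_def B1_def)
    have C1: "C \<noteq> 1" using K[OF nA1] C by simp
    obtain j :: int where j: "good (\<lambda>i. C powi j * A1 i * inverse (C powi j)) C"
      using exists_good[OF nA1 C(2,1)] by blast
    obtain k :: int where k: "good (\<lambda>i. C powi k * B1 i * inverse (C powi k)) C"
      using exists_good[OF nB1 C(3,1)] by blast
    \<comment> \<open>The two tuples are brought near \<open>1\<close> by different powers of \<open>C\<close>; the smaller exponent is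
      subtracted, so that \<open>aligned\<close> is used with a natural number \<open>s\<close>.\<close>
    have conj: "C powi a * y * inverse (C powi a)
        = C ^ nat (a - b) * (C powi b * y * inverse (C powi b)) * inverse (C ^ nat (a - b))"
      if "b \<le> a" for a b y
    proof -
      have "C powi a = C powi (int (nat (a - b))) * C powi b"
        using that by (simp only: powi_add[symmetric]) simp
      then have "C powi a = C ^ nat (a - b) * C powi b" by (simp only: power_int_of_nat)
      then show ?thesis by (simp add: mult.assoc)
    qed
    have cancel: "y = z" if "C powi a * y * inverse (C powi a) = C powi a * z * inverse (C powi a)"
      for a y z using that by (simp add: mult.assoc)
    have "\<forall>i \<in> X. A1 i = B1 i"
    proof (cases "k \<le> j")
      case True
      have "ev (\<lambda>i. C powi j * A1 i * inverse (C powi j)) u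
          = C ^ nat (j - k) * ev (\<lambda>i. C powi k * B1 i * inverse (C powi k)) u * inverse (C ^ nat (j - k))"
        by (simp only: ev_conj eq1 conj[OF True])
      from aligned[OF C(1) C1 j k this]
      have "C powi j * A1 i * inverse (C powi j) = C powi j * B1 i * inverse (C powi j)"
        if "i \<in> X" for i using that by (simp only: conj[OF True])
      then show ?thesis using cancel by blast
    next
      case False
      then have le: "j \<le> k" by simp
      have "ev (\<lambda>i. C powi k * B1 i * inverse (C powi k)) u
          = C ^ nat (k - j) * ev (\<lambda>i. C powi j * A1 i * inverse (C powi j)) u * inverse (C ^ nat (k - j))"
        by (simp only: ev_conj eq1 conj[OF le])
      from aligned[OF C(1) C1 k j this]
      have "C powi k * B1 i * inverse (C powi k) = C powi k * A1 i * inverse (C powi k)"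
        if "i \<in> X" for i using that by (simp only: conj[OF le])
      then show ?thesis using cancel by fastforce
    qed
    then show ?thesis by (simp add: A1_def B1_def)
  qed
  have "set d \<subseteq> X \<times> UNIV"
    using set_spread_word[of "wpow c M" xs] set_wpow_subset[OF c, of M] xs by (auto simp: d_def)
  then have "set u \<subseteq> X \<times> UNIV"
    using set_separated_word[of "wpow c N" d xs] set_wpow_subset[OF c, of N] xs by (auto simp: u_def)
  then show ?thesis using c determined by (intro exI[of _ c] exI[of _ u]) blast
qed

section \<open>Endomorphisms as evaluations\<close>

lemma ev_reduce: "ev A (reduce w) = ev A w"
proof (induction w)
  case (Cons a w)
  have "ev A (cancel_cons a v) = ev A (a # v)" for v
  proof (cases v)
    case (Cons b v')
    then show ?thesis by (auto simp: inv_letter_def)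
  qed simp
  then have "ev A (reduce (a # w)) = ev A (a # reduce w)" by (simp only: reduce_def foldr.simps o_apply)
  then show ?case using Cons.IH by simp
qed (simp add: reduce_def)

lemma hom_eq_ev:
  assumes \<phi>: "\<phi> \<in> hom (free_group X) (free_group X)"
    and A: "\<And>x. x \<in> X \<Longrightarrow> A x = fgroup_of (\<phi> [(x, True)])"
    and w: "w \<in> carrier (free_group X)"
  shows "\<phi> w = word (ev A w)"
proof (rule free_group_hom_unique[OF group_free_group[of UNIV] _ _ _ w, of \<phi> "\<lambda>w. word (ev A w)"])
  show "\<phi> \<in> hom (free_group X) (free_group UNIV)"
    using \<phi> by (auto simp: hom_def free_group_def)
  show "(\<lambda>w. word (ev A w)) \<in> hom (free_group X) (free_group UNIV)"
    by (auto simp: hom_def free_group_def ev_reduce times_fgroup.rep_eq)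
  show "\<phi> [(x, True)] = word (ev A [(x, True)])" if "x \<in> X" for x
  proof -
    have "[(x, True)] \<in> carrier (free_group X)"
      using that by (simp add: free_group_def reduced_Cons)
    then have "reduced (\<phi> [(x, True)])"
      using \<phi> by (auto simp: hom_def free_group_def)
    then show ?thesis using A[OF that] by (simp add: fgroup_of_inverse)
  qed
qed

text \<open>
  Euclid's algorithm: among the nontrivial values choose one of least translation length. Any other
  value commutes with it, and the remainder of the division of exponents belongs to a value of smaller
  translation length, which must be trivial.
\<close>

lemma commuting_values_cyclic:
  fixes A :: "'i \<Rightarrow> 'a fgroup"
  assumes "\<And>i j. i \<in> X \<Longrightarrow> j \<in> X \<Longrightarrow> commute (A i) (A j)"
  shows "\<exists>v. set v \<subseteq> X \<times> UNIV \<and> (\<forall>w. set w \<subseteq> X \<times> UNIV \<longrightarrow> (\<exists>n :: int. ev A w = ev A v powi n))"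
proof (cases "\<exists>v. set v \<subseteq> X \<times> UNIV \<and> ev A v \<noteq> 1")
  case False
  then show ?thesis by (intro exI[of _ "[]"]) (auto intro!: exI[of _ 0])
next
  case True
  have comm1: "commute (A i) (ev A w)" if "i \<in> X" "set w \<subseteq> X \<times> UNIV" for i w
    using that(2) by (induction w) (auto intro!: commute_mult simp: assms that(1))
  have comm: "commute (ev A v) (ev A w)" if "set v \<subseteq> X \<times> UNIV" "set w \<subseteq> X \<times> UNIV" for v w
    using that(1)
  proof (induction v)
    case (Cons a v)
    then have "commute (ev A w) (A (fst a))" "commute (ev A w) (ev A v)"
      using comm1[of "fst a" w] that(2) commute_sym by auto
    then have "commute (ev A w) (ev A (a # v))" by (auto intro: commute_mult)
    then show ?case by (rule commute_sym)
  qed simp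
  from True obtain v0 where v0: "set v0 \<subseteq> X \<times> UNIV \<and> ev A v0 \<noteq> 1" by blast
  obtain v where v: "set v \<subseteq> X \<times> UNIV" "ev A v \<noteq> 1"
    and min: "\<And>w. set w \<subseteq> X \<times> UNIV \<Longrightarrow> ev A w \<noteq> 1 \<Longrightarrow> ell (ev A v) \<le> ell (ev A w)"
    using ex_has_least_nat[of "\<lambda>v. set v \<subseteq> X \<times> UNIV \<and> ev A v \<noteq> 1", OF v0, of "\<lambda>v. ell (ev A v)"]
    by blast
  have "\<exists>n :: int. ev A w = ev A v powi n" if w: "set w \<subseteq> X \<times> UNIV" for w
  proof -
    obtain h i j where h: "ev A v = h powi i" "ev A w = h powi j"
      using commute_common_root[OF comm[OF v(1) w]] by blast
    have i: "i \<noteq> 0" using v(2) h(1) by auto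
    define q where "q = j div i"
    define r where "r = w @ (if q \<ge> 0 then winv (wpow v (nat q)) else wpow v (nat (- q)))"
    have r: "set r \<subseteq> X \<times> UNIV"
      using w set_wpow_subset[OF v(1)] set_winv_subset[OF set_wpow_subset[OF v(1)]]
      by (auto simp: r_def)
    have "ev A r = ev A w * ev A v powi (- q)"
      by (auto simp: r_def power_int_def inverse_power_group)
    also have "\<dots> = h powi (j + i * - q)" by (simp only: h powi_add powi_mult)
    also have "j + i * - q = j mod i" by (simp add: q_def minus_mult_div_eq_mod)
    finally have er: "ev A r = h powi (j mod i)" .
    have "ev A r = 1"
    proof (rule ccontr)
      assume "ev A r \<noteq> 1"
      then have "nat \<bar>i\<bar> * ell h \<le> nat \<bar>j mod i\<bar> * ell h"
        using min[OF r \<open>ev A r \<noteq> 1\<close>] by (simp only: er h(1) ell_powi)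
      moreover have "ell h > 0" using v(2) h(1) by (metis ell_eq_0 neq0_conv powi_eq_one_iff)
      ultimately have "\<bar>i\<bar> \<le> \<bar>j mod i\<bar>" by simp
      moreover have "\<bar>j mod i\<bar> < \<bar>i\<bar>" using i by (rule abs_mod_less)
      ultimately show False by simp
    qed
    then have "ev A w * ev A v powi (- q) = 1"
      using \<open>ev A r = ev A w * ev A v powi (- q)\<close> by simp
    moreover have "ev A w = (ev A w * ev A v powi (- q)) * ev A v powi q"
      by (simp add: powi_minus mult.assoc)
    ultimately have "ev A w = ev A v powi q" by simp
    then show ?thesis by blast
  qed
  then show ?thesis using v(1) by blast
qed

text \<open>
  The image consists of the values of words, so \<open>commuting_values_cyclic\<close> exhibits it as an epimorphic
  image of the integers.
\<close>

lemma cyclic_image_if_commuting: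
  assumes \<phi>: "\<phi> \<in> hom (free_group X) (free_group X)"
    and A: "\<And>x. x \<in> X \<Longrightarrow> A x = fgroup_of (\<phi> [(x, True)])"
    and comm: "\<And>i j. i \<in> X \<Longrightarrow> j \<in> X \<Longrightarrow> commute (A i) (A j)"
  shows "cyclic_group ((free_group X)\<lparr>carrier := \<phi> ` carrier (free_group X)\<rparr>)"
proof -
  interpret \<phi>: group_hom "free_group X" "free_group X" \<phi>
    by (simp add: group_hom_def group_hom_axioms_def group_free_group \<phi>)
  define I where "I = (free_group X)\<lparr>carrier := \<phi> ` carrier (free_group X)\<rparr>"
  have I: "group I" unfolding I_def
    by (rule subgroup.subgroup_is_group[OF \<phi>.img_is_subgroup group_free_group])
  obtain v where v: "set v \<subseteq> X \<times> UNIV"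
    "\<And>w. set w \<subseteq> X \<times> UNIV \<Longrightarrow> \<exists>n :: int. ev A w = ev A v powi n"
    using commuting_values_cyclic[of X A] comm by blast
  have carr: "reduce w \<in> carrier (free_group X)" if "set w \<subseteq> X \<times> UNIV" for w
    using that set_reduce_subset[of w] by (auto simp: free_group_def reduced_reduce)
  have "word (ev A v powi n) \<in> carrier I" for n
  proof -
    define w where "w = (if n \<ge> 0 then wpow v (nat n) else wpow (winv v) (nat (- n)))"
    have "set w \<subseteq> X \<times> UNIV"
      using set_wpow_subset[OF v(1)] set_wpow_subset[OF set_winv_subset[OF v(1)]] by (auto simp: w_def)
    then have "\<phi> (reduce w) \<in> carrier I" by (auto simp: I_def carr)
    moreover have "\<phi> (reduce w) = word (ev A w)"
      using hom_eq_ev[OF \<phi> A carr] \<open>set w \<subseteq> X \<times> UNIV\<close> by (simp add: ev_reduce)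
    moreover have "ev A w = ev A v powi n" by (simp add: w_def power_int_def)
    ultimately show ?thesis by simp
  qed
  then have 1: "range (\<lambda>n :: int. word (ev A v powi n)) \<subseteq> carrier I" by blast
  have "\<exists>n :: int. y = word (ev A v powi n)" if y: "y \<in> carrier I" for y
  proof -
    obtain w where w: "w \<in> carrier (free_group X)" "y = \<phi> w" using y by (auto simp: I_def)
    then have "y = word (ev A w)" using hom_eq_ev[OF \<phi> A] by blast
    moreover have "set w \<subseteq> X \<times> UNIV" using w(1) by (simp add: free_group_def)
    ultimately show ?thesis using v(2) by metis
  qed
  then have "carrier I \<subseteq> range (\<lambda>n :: int. word (ev A v powi n))" by blast
  with 1 have "range (\<lambda>n :: int. word (ev A v powi n)) = carrier I" by (rule subset_antisym)
  moreover have "(\<lambda>n :: int. word (ev A v powi n)) \<in> hom integer_group I"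
  proof (rule homI)
    fix i j :: int
    show "word (ev A v powi i) \<in> carrier I" using 1 by blast
    show "word (ev A v powi (i \<otimes>\<^bsub>integer_group\<^esub> j))
        = word (ev A v powi i) \<otimes>\<^bsub>I\<^esub> word (ev A v powi j)"
      by (simp add: powi_add times_fgroup.rep_eq I_def free_group_def)
  qed
  ultimately have "(\<lambda>n :: int. word (ev A v powi n)) \<in> epi integer_group I"
    by (simp add: epi_def)
  then have "cyclic_group I"
    using group.cyclic_group_epimorphic_image[OF group_integer_group _ cyclic_integer_group I] by blast
  then show ?thesis by (simp only: I_def)
qed

theorem corollary2:
  fixes m :: nat
  assumes "m \<ge> 2"
  shows "\<exists>u1 \<in> carrier (free_group {..<m}). \<exists>u2 \<in> carrier (free_group {..<m}).
    \<forall>\<phi> \<in> hom (free_group {..<m}) (free_group {..<m}).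
    \<forall>\<psi> \<in> hom (free_group {..<m}) (free_group {..<m}).
      \<not> cyclic_group ((free_group {..<m})\<lparr>carrier := \<phi> ` carrier (free_group {..<m})\<rparr>) \<longrightarrow>
      \<not> cyclic_group ((free_group {..<m})\<lparr>carrier := \<psi> ` carrier (free_group {..<m})\<rparr>) \<longrightarrow>
      \<phi> u1 = \<psi> u1 \<longrightarrow> \<phi> u2 = \<psi> u2 \<longrightarrow>
      (\<forall>w \<in> carrier (free_group {..<m}). \<phi> w = \<psi> w)"
proof -
  define F where "F = free_group {..<m}"
  obtain u1 u2 :: "nat letter list" where
    u: "set u1 \<subseteq> {..<m} \<times> UNIV" "set u2 \<subseteq> {..<m} \<times> UNIV"
    and det: "\<forall>A B :: nat \<Rightarrow> nat fgroup.
        (\<exists>i \<in> {..<m}. \<exists>j \<in> {..<m}. \<not> commute (A i) (A j)) \<longrightarrow>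
        (\<exists>i \<in> {..<m}. \<exists>j \<in> {..<m}. \<not> commute (B i) (B j)) \<longrightarrow>
        ev A u1 = ev B u1 \<longrightarrow> ev A u2 = ev B u2 \<longrightarrow> (\<forall>i \<in> {..<m}. A i = B i)"
    using two_words_determine[OF finite_lessThan, of m] by (elim exE conjE)
  have carr: "reduce u1 \<in> carrier F" "reduce u2 \<in> carrier F"
    using u set_reduce_subset[of u1] set_reduce_subset[of u2]
    by (auto simp: F_def free_group_def reduced_reduce)
  have "\<phi> w = \<psi> w"
    if \<phi>: "\<phi> \<in> hom F F" and \<psi>: "\<psi> \<in> hom F F"
      and n\<phi>: "\<not> cyclic_group (F\<lparr>carrier := \<phi> ` carrier F\<rparr>)"
      and n\<psi>: "\<not> cyclic_group (F\<lparr>carrier := \<psi> ` carrier F\<rparr>)"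
      and eq: "\<phi> (reduce u1) = \<psi> (reduce u1)" "\<phi> (reduce u2) = \<psi> (reduce u2)"
      and w: "w \<in> carrier F" for \<phi> \<psi> w
  proof -
    define A B where "A x = fgroup_of (\<phi> [(x, True)])" and "B x = fgroup_of (\<psi> [(x, True)])"
      for x :: nat
    have evA: "\<phi> v = word (ev A v)" and evB: "\<psi> v = word (ev B v)" if "v \<in> carrier F" for v
      using hom_eq_ev[OF \<phi>[unfolded F_def] _ that[unfolded F_def], of A]
        hom_eq_ev[OF \<psi>[unfolded F_def] _ that[unfolded F_def], of B]
      by (simp_all add: A_def B_def)
    have "\<exists>i \<in> {..<m}. \<exists>j \<in> {..<m}. \<not> commute (A i) (A j)"
      using cyclic_image_if_commuting[OF \<phi>[unfolded F_def], of A] n\<phi> by (auto simp: A_def F_def)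
    moreover have "\<exists>i \<in> {..<m}. \<exists>j \<in> {..<m}. \<not> commute (B i) (B j)"
      using cyclic_image_if_commuting[OF \<psi>[unfolded F_def], of B] n\<psi> by (auto simp: B_def F_def)
    moreover have "ev A u1 = ev B u1" "ev A u2 = ev B u2"
      using eq carr by (simp_all add: evA evB ev_reduce word_inject)
    ultimately have AB: "\<forall>i \<in> {..<m}. A i = B i" by (rule det[THEN spec, THEN spec, THEN mp, THEN mp, THEN mp, THEN mp])
    have "set w \<subseteq> {..<m} \<times> UNIV" using w by (simp add: F_def free_group_def)
    then have "ev A w = ev B w" using AB by (induction w) auto
    then show ?thesis by (simp add: evA[OF w] evB[OF w])
  qed
  then show ?thesis using carr unfolding F_def by blast
qed

end
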